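(* Fix an exceptional configuration $\mathbf{E}=(E_0,E_1,\ldots,E_r)$ on $X_r$. Let $H\equiv dE_0-m_1E_1-\cdots-m_rE_r$ be an $\mathbf{E}$-standard divisor and let $D$ be a semi-standard divisor on $X_r$. Then for $\sigma\in W_r$ (the Weyl group), the minimum value of $H.\sigma(D)$ occurs exactly when $\sigma(D)$ is $\mathbf{E}$-semi-standard. Otherwise said, if $\mathbf{F}=(F_0,F_1,\ldots,F_r)$ is an exceptional configuration for which $D=d'F_0-m_1'F_1-\cdots-m_r'F_r$ is $\mathbf{F}$-semi-standard, and $D'=d'E_0-m_1'E_1-\cdots-m_r'E_r$, then $$H.D\ \geq\ H.D'.$$
   Context: Let $\kappa$ be a field, $r\ge 0$ an integer, and $\Lambda_r$ the residue field at the generic point of $(\mathbb{P}^2_\kappa)^r$. $X_r$ denotes the blow-up of $\mathbb{P}^2_{\Lambda_r}$ at the tautological sequence of $r$ points $x_1,\ldots,x_r$ ("the blow-up of the plane at $r$ generic points"). $K_r$ is its canonical class and $A.B$ is the intersection product on $\mathrm{Pic}(X_r)$. An exceptional configuration on $X_r$ is a sequence $\mathbf{E}=(E_0,E_1,\ldots,E_r)$ of pairwise orthogonal effective, irreducible classes with $E_0^2=1$, $E_0.K_r=-3$, and $E_j^2=-1=E_j.K_r$ for $1\le j\le r$. It is a basis of $\mathrm{Pic}(X_r)$. The Weyl group $W_r$ is the group of automorphisms of $\mathrm{Pic}(X_r)$ generated, for any fixed exceptional configuration $\mathbf{E}$, by the reflections $x\mapsto x+(x.r_i)\,r_i$ with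 $r_0=E_0-E_1-E_2-E_3$ (only if $r\ge 3$) and $r_i=E_i-E_{i+1}$ for $1\le i\le r-1$. It preserves the intersection form, fixes $K_r$, and acts simply transitively on exceptional configurations. A class $H\equiv dE_0-m_1E_1-\cdots-m_rE_r$ is $\mathbf{E}$-standard if $d\ge m_1\ge\cdots\ge m_r\ge 0$, $d\ge m_1+m_2$ and $d\ge m_1+m_2+m_3$. It is $\mathbf{E}$-semi-standard if $d\ge 0$, $d\ge m_1+m_2+m_3$ and $d\ge m_1\ge m_2\ge\cdots\ge m_r$ (some $m_i$ may be negative). When $r<3$, inequalities involving an $m_i$ with $i>r$ are omitted. A class is standard (resp. semi-standard) if it is $\mathbf{E}$-standard (resp. $\mathbf{E}$-semi-standard) for some exceptional configuration $\mathbf{E}$.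
   Formalization: "Exactly when" is proved as: some σ(D) is E-semi-standard and every such σ attains the minimum; the converse is dropped, being false (r=2, H=E_0, D=2E_0−E_1, swap E_1 and E_2). The inequality H.D ≥ H.D' is proved in full. *)

theory Defs
  imports "HOL-Computational_Algebra.Computational_Algebra" "HOL-Library.Poly_Mapping"
begin

text \<open>
  Let \<open>\<Lambda>\<^sub>r\<close> be the function field of \<open>(P\<^sup>2)\<^sup>r\<close> over \<open>\<kappa>\<close>. It is \<open>\<kappa>(s\<^sub>1, t\<^sub>1, \<dots>, s\<^sub>r, t\<^sub>r)\<close>,
  where \<open>s\<^sub>i = X\<^sub>1/X\<^sub>0\<close> and \<open>t\<^sub>i = X\<^sub>2/X\<^sub>0\<close> are the affine coordinates on the \<open>i\<close>-th factor, and the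
  \<open>i\<close>-th tautological point is \<open>x\<^sub>i = (1 : s\<^sub>i : t\<^sub>i)\<close>. As a type cannot depend on \<open>r\<close>, the field
  \<open>\<Lambda>\<^sub>r\<close> is given by a type \<open>'l\<close>, an embedding \<open>\<iota>\<close> of the base field and the elements \<open>s\<^sub>i, t\<^sub>i\<close>,
  which are algebraically independent over the base field and generate \<open>'l\<close> over it.
  The points are numbered from \<open>1\<close> to \<open>r\<close>; values of \<open>s\<close> and \<open>t\<close> at other indices are irrelevant.
\<close>

definition mpoly_eval :: "('k \<Rightarrow> 'l) \<Rightarrow> ('v \<Rightarrow> 'l) \<Rightarrow> (('v \<Rightarrow>\<^sub>0 nat) \<Rightarrow>\<^sub>0 'k::zero) \<Rightarrow> 'l::comm_semiring_1" where
  "mpoly_eval \<iota> x P = (\<Sum>\<mu>\<in>Poly_Mapping.keys P. \<iota> (Poly_Mapping.lookup P \<mu>) *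
     (\<Prod>v\<in>Poly_Mapping.keys \<mu>. x v ^ Poly_Mapping.lookup \<mu> v))"

definition mpoly_vars :: "(('v \<Rightarrow>\<^sub>0 nat) \<Rightarrow>\<^sub>0 'k::zero) \<Rightarrow> 'v set" where
  "mpoly_vars P = (\<Union>\<mu>\<in>Poly_Mapping.keys P. Poly_Mapping.keys \<mu>)"

definition generic_points ::
    "('k::field \<Rightarrow> 'l::field) \<Rightarrow> nat \<Rightarrow> (nat \<Rightarrow> 'l) \<Rightarrow> (nat \<Rightarrow> 'l) \<Rightarrow> bool" where
  "generic_points \<iota> r s t \<longleftrightarrow>
     \<iota> 1 = 1 \<and> (\<forall>u v. \<iota> (u + v) = \<iota> u + \<iota> v) \<and> (\<forall>u v. \<iota> (u * v) = \<iota> u * \<iota> v) \<and>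
     (\<forall>P. mpoly_vars P \<subseteq> {1..r} <+> {1..r} \<and> mpoly_eval \<iota> (case_sum s t) P = 0 \<longrightarrow> P = 0) \<and>
     (\<forall>z. \<exists>P Q. mpoly_vars P \<subseteq> {1..r} <+> {1..r} \<and> mpoly_vars Q \<subseteq> {1..r} <+> {1..r} \<and>
        mpoly_eval \<iota> (case_sum s t) Q \<noteq> 0 \<and>
        z = mpoly_eval \<iota> (case_sum s t) P / mpoly_eval \<iota> (case_sum s t) Q)"

text \<open>
  Plane curves: \<open>'l poly poly poly\<close> is \<open>\<Lambda>\<^sub>r[X\<^sub>2][X\<^sub>1][X\<^sub>0]\<close>, so the coefficient of
  \<open>X\<^sub>0\<^sup>i X\<^sub>1\<^sup>j X\<^sub>2\<^sup>k\<close> in \<open>f\<close> is \<open>coeff (coeff (coeff f i) j) k\<close>.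
\<close>

definition ternary_form :: "nat \<Rightarrow> 'l::field poly poly poly \<Rightarrow> bool" where
  "ternary_form d f \<longleftrightarrow> (\<forall>i j k. coeff (coeff (coeff f i) j) k \<noteq> 0 \<longrightarrow> i + j + k = d)"

text \<open>
  With \<open>x = X\<^sub>1/X\<^sub>0\<close> and \<open>y = X\<^sub>2/X\<^sub>0\<close>, the affine equation of the curve \<open>f = 0\<close> in the
  chart \<open>X\<^sub>0 \<noteq> 0\<close> is \<open>F(x,y) = f(1,x,y)\<close>. The next definition is \<open>F(x + a, y + b)\<close>, in which
  \<open>coeff (coeff _ j) k\<close> is the coefficient of \<open>x\<^sup>j y\<^sup>k\<close>.
\<close>

definition local_equation :: "'l::field poly poly poly \<Rightarrow> 'l \<Rightarrow> 'l \<Rightarrow> 'l poly poly" where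
  "local_equation f a b =
     pcompose (map_poly (\<lambda>c. pcompose c [:b, 1:]) (poly f 1)) [:[:a:], 1:]"

text \<open>The multiplicity of the curve \<open>f = 0\<close> at the point \<open>(1 : a : b)\<close>; only used for forms \<open>f \<noteq> 0\<close>.\<close>

definition multiplicity_at :: "'l::field poly poly poly \<Rightarrow> 'l \<Rightarrow> 'l \<Rightarrow> nat" where
  "multiplicity_at f a b =
     (LEAST m. \<exists>j k. j + k = m \<and> coeff (coeff (local_equation f a b) j) k \<noteq> 0)"

text \<open>
  \<open>Pic(X\<^sub>r)\<close> is free on the class of the total transform of a line and the classes of the \<open>r\<close> exceptional
  curves of the blow-up. A class is given by its coordinates in this basis: coordinate \<open>0\<close>
  belongs to the line, coordinate \<open>i\<close> with \<open>1 \<le> i \<le> r\<close> to the exceptional curve over \<open>x\<^sub>i\<close>, and all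
  coordinates beyond \<open>r\<close> are \<open>0\<close>.
\<close>

type_synonym divisor_class = "nat \<Rightarrow> int"

definition intersection :: "nat \<Rightarrow> divisor_class \<Rightarrow> divisor_class \<Rightarrow> int" where
  "intersection r A B = A 0 * B 0 - (\<Sum>i=1..r. A i * B i)"

definition canonical_class :: "nat \<Rightarrow> divisor_class" where
  "canonical_class r = (\<lambda>i. if i = 0 then -3 else if i \<le> r then 1 else 0)"

definition blowup_exceptional_class :: "nat \<Rightarrow> divisor_class" where
  "blowup_exceptional_class i = (\<lambda>k. if k = i then 1 else 0)"

definition proper_transform_class ::
    "nat \<Rightarrow> (nat \<Rightarrow> 'l::field) \<Rightarrow> (nat \<Rightarrow> 'l) \<Rightarrow> nat \<Rightarrow> 'l poly poly poly \<Rightarrow> divisor_class" where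
  "proper_transform_class r s t d f =
     (\<lambda>i. if i = 0 then int d else if i \<le> r then - int (multiplicity_at f (s i) (t i)) else 0)"

text \<open>
  The effective, irreducible classes, i.e. the classes of integral curves on \<open>X\<^sub>r\<close>: such a curve is an
  exceptional curve of the blow-up or the proper transform of an integral plane curve over \<open>\<Lambda>\<^sub>r\<close>.
\<close>

definition effective_irreducible_class ::
    "nat \<Rightarrow> (nat \<Rightarrow> 'l::field) \<Rightarrow> (nat \<Rightarrow> 'l) \<Rightarrow> divisor_class \<Rightarrow> bool" where
  "effective_irreducible_class r s t C \<longleftrightarrow>
     (\<exists>i\<in>{1..r}. C = blowup_exceptional_class i) \<or>
     (\<exists>d f. ternary_form d f \<and> irreducible f \<and> C = proper_transform_class r s t d f)"

definition exceptional_configuration ::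
    "nat \<Rightarrow> (nat \<Rightarrow> 'l::field) \<Rightarrow> (nat \<Rightarrow> 'l) \<Rightarrow> (nat \<Rightarrow> divisor_class) \<Rightarrow> bool" where
  "exceptional_configuration r s t E \<longleftrightarrow>
     (\<forall>i\<le>r. effective_irreducible_class r s t (E i)) \<and>
     (\<forall>i\<le>r. \<forall>j\<le>r. i \<noteq> j \<longrightarrow> intersection r (E i) (E j) = 0) \<and>
     intersection r (E 0) (E 0) = 1 \<and> intersection r (E 0) (canonical_class r) = -3 \<and>
     (\<forall>j\<in>{1..r}. intersection r (E j) (E j) = -1 \<and> intersection r (E j) (canonical_class r) = -1)"

definition reflection :: "nat \<Rightarrow> divisor_class \<Rightarrow> divisor_class \<Rightarrow> divisor_class" where
  "reflection r v x = (\<lambda>k. x k + intersection r x v * v k)"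

definition simple_roots :: "nat \<Rightarrow> (nat \<Rightarrow> divisor_class) \<Rightarrow> divisor_class set" where
  "simple_roots r E =
     {v. 3 \<le> r \<and> v = (\<lambda>k. E 0 k - E 1 k - E 2 k - E 3 k)} \<union>
     {v. \<exists>i. 1 \<le> i \<and> i < r \<and> v = (\<lambda>k. E i k - E (i + 1) k)}"

text \<open>
  The reflections are involutions, so the monoid they generate is the group they generate.
\<close>

inductive_set weyl_group ::
    "nat \<Rightarrow> (nat \<Rightarrow> divisor_class) \<Rightarrow> (divisor_class \<Rightarrow> divisor_class) set"
  for r :: nat and E :: "nat \<Rightarrow> divisor_class" where
  weyl_id: "id \<in> weyl_group r E"
| weyl_step: "\<sigma> \<in> weyl_group r E \<Longrightarrow> v \<in> simple_roots r E \<Longrightarrow> reflection r v \<circ> \<sigma> \<in> weyl_group r E"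

text \<open>The class \<open>d E\<^sub>0 - m\<^sub>1 E\<^sub>1 - \<dots> - m\<^sub>r E\<^sub>r\<close>.\<close>

definition class_of :: "nat \<Rightarrow> (nat \<Rightarrow> divisor_class) \<Rightarrow> int \<Rightarrow> (nat \<Rightarrow> int) \<Rightarrow> divisor_class" where
  "class_of r E d m = (\<lambda>k. d * E 0 k - (\<Sum>i=1..r. m i * E i k))"

text \<open>For \<open>r = 0\<close> the chain \<open>d \<ge> m\<^sub>1 \<ge> \<dots> \<ge> m\<^sub>r \<ge> 0\<close> is read as \<open>d \<ge> 0\<close>.\<close>

definition standard_coeffs :: "nat \<Rightarrow> int \<Rightarrow> (nat \<Rightarrow> int) \<Rightarrow> bool" where
  "standard_coeffs r d m \<longleftrightarrow>
     0 \<le> d \<and> (1 \<le> r \<longrightarrow> m 1 \<le> d \<and> 0 \<le> m r) \<and>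
     (\<forall>i. 1 \<le> i \<and> i < r \<longrightarrow> m (i + 1) \<le> m i) \<and>
     (2 \<le> r \<longrightarrow> m 1 + m 2 \<le> d) \<and> (3 \<le> r \<longrightarrow> m 1 + m 2 + m 3 \<le> d)"

definition semi_standard_coeffs :: "nat \<Rightarrow> int \<Rightarrow> (nat \<Rightarrow> int) \<Rightarrow> bool" where
  "semi_standard_coeffs r d m \<longleftrightarrow>
     0 \<le> d \<and> (1 \<le> r \<longrightarrow> m 1 \<le> d) \<and>
     (\<forall>i. 1 \<le> i \<and> i < r \<longrightarrow> m (i + 1) \<le> m i) \<and>
     (3 \<le> r \<longrightarrow> m 1 + m 2 + m 3 \<le> d)"

definition semi_standard_wrt :: "nat \<Rightarrow> (nat \<Rightarrow> divisor_class) \<Rightarrow> divisor_class \<Rightarrow> bool" where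
  "semi_standard_wrt r E D \<longleftrightarrow> (\<exists>d m. D = class_of r E d m \<and> semi_standard_coeffs r d m)"

definition semi_standard ::
    "nat \<Rightarrow> (nat \<Rightarrow> 'l::field) \<Rightarrow> (nat \<Rightarrow> 'l) \<Rightarrow> divisor_class \<Rightarrow> bool" where
  "semi_standard r s t D \<longleftrightarrow> (\<exists>F. exceptional_configuration r s t F \<and> semi_standard_wrt r F D)"

end

theory Submission
  imports "Berlekamp_Zassenhaus.Unique_Factorization_Poly" Defs
begin

no_notation eq_class_of (\<open>class'_of\<index>\<close>)

text \<open>
  The inequality is a fact about Coxeter groups: if \<open>H\<close> and \<open>D\<close> have nonnegative product with all simple
  roots, then \<open>H.\<sigma>(D) \<ge> H.D\<close>, because appending a letter to a reduced word adds to \<open>\<sigma>(D)\<close> a nonnegative multiple of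
  the image of a simple root under a shorter word, and that image is a positive root.

  It remains to see that any two exceptional configurations are in one orbit of the Weyl group.
  By Riemann--Roch, every class \<open>x\<close> with \<open>x\<^sup>2 = x.K = -1\<close> and nonnegative degree is effective, and this
  applies to all Weyl translates of the exceptional curves. The class \<open>F\<^sub>0\<close> of an irreducible curve with
  \<open>F\<^sub>0\<^sup>2 = 1\<close> meets these classes nonnegatively by Bezout's theorem. So \<open>F\<^sub>0\<close> has nonnegative multiplicities
  with respect to every Weyl translate of the standard basis, and Noether's inequality
  lowers its degree by quadratic transformations until it is the class of a line. The rest of the
  configuration is then a permutation of the exceptional curves.
\<close>

section \<open>The Weyl group\<close>

text \<open>The obstacle is that a Weyl translate \<open>x\<close> of an exceptional curve is not
  known to be a curve before transitivity is proved, so products with it have to be controlled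
  numerically. The equations \<open>x\<^sup>2 = x.K = -1\<close> leave at least one more coefficient
  than conditions, which gives a form in the class of \<open>x\<close>. That form may contain the
  curve of \<open>F\<^sub>0\<close> as a component; because \<open>F\<^sub>0\<^sup>2 > 0\<close>,
  splitting off copies of the curve only strengthens the inequality. The nonnegative degree that
  effectivity presupposes is itself an instance of the minimality theorem for orbits, so the Coxeter
  argument is used twice. Bezout's bound is also obtained by counting. Triangular numbers satisfy
  \<open>T(a + b) = T(a) + T(b) + a b\<close>, and the cross term accounts for the local
  contribution at each point as well as for the product of the degrees. Genericity supplies distinct
  \<open>s i\<close>, so vertical lines separate the points.\<close>

lemma intersection_commute: "intersection r x y = intersection r y x"
  by (simp add: intersection_def mult.commute)

lemma intersection_linear_left [simp]:
  "intersection r (\<lambda>k. x k + y k) z = intersection r x z + intersection r y z"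
  "intersection r (\<lambda>k. x k - y k) z = intersection r x z - intersection r y z"
  "intersection r (\<lambda>k. c * x k) z = c * intersection r x z"
  "intersection r (\<lambda>k. - x k) z = - intersection r x z"
  by (simp_all add: intersection_def ring_distribs sum.distrib sum_subtractf sum_negf
      sum_distrib_left mult.assoc mult.left_commute)

lemma intersection_linear_right [simp]:
  "intersection r z (\<lambda>k. x k + y k) = intersection r z x + intersection r z y"
  "intersection r z (\<lambda>k. x k - y k) = intersection r z x - intersection r z y"
  "intersection r z (\<lambda>k. c * x k) = c * intersection r z x"
  "intersection r z (\<lambda>k. - x k) = - intersection r z x"
  by (simp_all add: intersection_def ring_distribs sum.distrib sum_subtractf sum_negf
      sum_distrib_left mult.assoc mult.left_commute)

lemma intersection_sum_left:
  "finite I \<Longrightarrow> intersection r (\<lambda>k. \<Sum>i\<in>I. f i k) z = (\<Sum>i\<in>I. intersection r (f i) z)"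
  by (induction I rule: finite_induct) (simp_all add: intersection_def)

definition lorentz_frame :: "nat \<Rightarrow> (nat \<Rightarrow> divisor_class) \<Rightarrow> bool" where
  "lorentz_frame r E \<longleftrightarrow> (\<forall>i\<le>r. \<forall>j\<le>r. intersection r (E i) (E j) =
     (if i \<noteq> j then 0 else if i = 0 then 1 else -1))"

definition dominant :: "nat \<Rightarrow> (nat \<Rightarrow> divisor_class) \<Rightarrow> divisor_class \<Rightarrow> bool" where
  "dominant r E H \<longleftrightarrow> (\<forall>v\<in>simple_roots r E. 0 \<le> intersection r H v)"

lemma simple_root_square:
  assumes "lorentz_frame r E" "v \<in> simple_roots r E"
  shows "intersection r v v = -2"
  using assms by (auto simp: simple_roots_def lorentz_frame_def)

text \<open>The diagram is simply laced: the root \<open>E 0 - E 1 - E 2 - E 3\<close> is joined to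
  \<open>E 3 - E 4\<close> alone, the others form a chain. Roots have square -2, so the usual -1 of
  neighbours appears as +1.\<close>

lemma simple_root_product:
  assumes "lorentz_frame r E" "u \<in> simple_roots r E" "v \<in> simple_roots r E" "u \<noteq> v"
  shows "intersection r u v = 0 \<or> intersection r u v = 1"
proof -
  let ?a = "\<lambda>k. E 0 k - E 1 k - E 2 k - E 3 k"
  let ?b = "\<lambda>i k. E i k - E (i + 1) k"
  have E: "intersection r (E i) (E j) = (if i \<noteq> j then 0 else if i = 0 then 1 else -1)"
    if "i \<le> r" "j \<le> r" for i j
    using assms(1) that by (auto simp: lorentz_frame_def)
  have ab: "intersection r ?a (?b i) \<in> {0, 1}" if "3 \<le> r" "1 \<le> i" "i < r" for i
    using that by (auto simp: E)
  have bb: "intersection r (?b i) (?b j) \<in> {0, 1}"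
    if "1 \<le> i" "i < r" "1 \<le> j" "j < r" "i \<noteq> j" for i j
    using that by (auto simp: E)
  show ?thesis
  proof (cases "3 \<le> r \<and> u = ?a")
    case True
    with assms(3,4) ab show ?thesis unfolding simple_roots_def by fastforce
  next
    case False
    then obtain i where i: "1 \<le> i" "i < r" "u = ?b i"
      using assms(2) unfolding simple_roots_def by blast
    show ?thesis
    proof (cases "3 \<le> r \<and> v = ?a")
      case True
      with i ab[of i] show ?thesis by (metis insertE intersection_commute singletonD)
    next
      case False
      then obtain j where j: "1 \<le> j" "j < r" "v = ?b j"
        using assms(3) unfolding simple_roots_def by blast
      with i assms(4) have "i \<noteq> j" by auto
      with i j bb[of i j] show ?thesis by simp
    qed
  qed
qed

lemma reflection_commute:
  assumes "intersection r u v = 0"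
  shows "reflection r u \<circ> reflection r v = reflection r v \<circ> reflection r u"
  using assms intersection_commute[of r u v] by (auto simp: reflection_def fun_eq_iff)

lemma reflection_braid:
  assumes "intersection r u u = -2" "intersection r v v = -2" "intersection r u v = 1"
  shows "reflection r u \<circ> reflection r v \<circ> reflection r u =
    reflection r v \<circ> reflection r u \<circ> reflection r v"
  using assms intersection_commute[of r u v]
  by (simp add: reflection_def fun_eq_iff) (simp add: algebra_simps)

lemma reflection_involution:
  assumes "intersection r v v = -2"
  shows "reflection r v \<circ> reflection r v = id"
  using assms by (simp add: reflection_def fun_eq_iff)

lemma intersection_reflection:
  assumes "intersection r v v = -2"
  shows "intersection r (reflection r v x) (reflection r v y) = intersection r x y"
  using assms intersection_commute[of r v y] by (simp add: reflection_def)

lemma weyl_group_linear: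
  assumes "\<sigma> \<in> weyl_group r E"
  shows "\<sigma> (\<lambda>k. x k + c * y k) = (\<lambda>k. \<sigma> x k + c * \<sigma> y k)"
  using assms
proof induction
  case (weyl_step \<sigma> v)
  then show ?case by (simp add: reflection_def) (simp add: fun_eq_iff algebra_simps)
qed simp

lemma weyl_group_isometry:
  assumes "lorentz_frame r E" "\<sigma> \<in> weyl_group r E"
  shows "intersection r (\<sigma> x) (\<sigma> y) = intersection r x y"
  using assms(2)
  by induction (simp_all add: intersection_reflection simple_root_square[OF assms(1)])

lemma weyl_group_comp:
  assumes "\<sigma> \<in> weyl_group r E" "\<tau> \<in> weyl_group r E"
  shows "\<sigma> \<circ> \<tau> \<in> weyl_group r E"
  using assms(1)
proof induction
  case (weyl_step \<sigma> v)
  then have "reflection r v \<circ> (\<sigma> \<circ> \<tau>) \<in> weyl_group r E"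
    by (intro weyl_group.weyl_step)
  then show ?case by (simp only: comp_assoc)
qed (simp add: assms(2))

lemma reflection_in_weyl_group: "v \<in> simple_roots r E \<Longrightarrow> reflection r v \<in> weyl_group r E"
  using weyl_step[OF weyl_id] by fastforce

lemma weyl_group_inverse:
  assumes "lorentz_frame r E" "\<sigma> \<in> weyl_group r E"
  shows "\<exists>\<tau>\<in>weyl_group r E. \<tau> \<circ> \<sigma> = id \<and> \<sigma> \<circ> \<tau> = id"
  using assms(2)
proof induction
  case weyl_id
  then show ?case by (intro bexI[of _ id]) (simp_all add: weyl_group.weyl_id)
next
  case (weyl_step \<sigma> v)
  then obtain \<tau> where \<tau>: "\<tau> \<in> weyl_group r E" "\<tau> \<circ> \<sigma> = id" "\<sigma> \<circ> \<tau> = id" by blast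
  have inv: "reflection r v \<circ> reflection r v = id"
    using simple_root_square[OF assms(1)] weyl_step by (intro reflection_involution) auto
  show ?case
  proof (intro bexI[of _ "\<tau> \<circ> reflection r v"] conjI)
    show "\<tau> \<circ> reflection r v \<circ> (reflection r v \<circ> \<sigma>) = id"
      using inv \<tau> by (metis comp_assoc comp_id)
    show "reflection r v \<circ> \<sigma> \<circ> (\<tau> \<circ> reflection r v) = id"
      using inv \<tau> by (metis comp_assoc comp_id)
    show "\<tau> \<circ> reflection r v \<in> weyl_group r E"
      using weyl_group_comp \<tau>(1) reflection_in_weyl_group weyl_step.hyps(2) by blast
  qed
qed

section \<open>Words and length in the Weyl group\<close>

definition root_word :: "nat \<Rightarrow> divisor_class list \<Rightarrow> divisor_class \<Rightarrow> divisor_class" where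
  "root_word r vs = foldr (\<lambda>v \<sigma>. reflection r v \<circ> \<sigma>) vs id"

definition weyl_length ::
    "nat \<Rightarrow> (nat \<Rightarrow> divisor_class) \<Rightarrow> (divisor_class \<Rightarrow> divisor_class) \<Rightarrow> nat" where
  "weyl_length r E \<sigma> =
     (LEAST n. \<exists>vs. set vs \<subseteq> simple_roots r E \<and> length vs = n \<and> root_word r vs = \<sigma>)"

lemma root_word_simps [simp]:
  "root_word r [] = id"
  "root_word r (v # vs) = reflection r v \<circ> root_word r vs"
  by (simp_all add: root_word_def)

lemma root_word_append: "root_word r (us @ vs) = root_word r us \<circ> root_word r vs"
  by (induction us) (simp_all add: comp_assoc)

lemma root_word_in_weyl_group:
  "set vs \<subseteq> simple_roots r E \<Longrightarrow> root_word r vs \<in> weyl_group r E"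
  by (induction vs) (auto intro: weyl_group.intros)

lemma weyl_group_root_word:
  assumes "\<sigma> \<in> weyl_group r E"
  shows "\<exists>vs. set vs \<subseteq> simple_roots r E \<and> root_word r vs = \<sigma>"
  using assms
proof induction
  case weyl_id
  then show ?case by (intro exI[of _ "[]"]) simp
next
  case (weyl_step \<sigma> v)
  then obtain vs where "set vs \<subseteq> simple_roots r E" "root_word r vs = \<sigma>" by blast
  with weyl_step show ?case by (intro exI[of _ "v # vs"]) simp
qed

lemma weyl_length_le:
  "set vs \<subseteq> simple_roots r E \<Longrightarrow> weyl_length r E (root_word r vs) \<le> length vs"
  unfolding weyl_length_def by (rule Least_le) blast

lemma reduced_word_exists:
  assumes "\<sigma> \<in> weyl_group r E"
  shows "\<exists>vs. set vs \<subseteq> simple_roots r E \<and> length vs = weyl_length r E \<sigma> \<and> root_word r vs = \<sigma>"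
proof -
  obtain vs where "set vs \<subseteq> simple_roots r E" "root_word r vs = \<sigma>"
    using weyl_group_root_word[OF assms] by blast
  then show ?thesis unfolding weyl_length_def
    by (intro LeastI[of "\<lambda>n. \<exists>vs. set vs \<subseteq> simple_roots r E \<and> length vs = n \<and> root_word r vs = \<sigma>"
          "length vs"]) blast
qed

lemma weyl_length_comp_reflection:
  assumes "\<sigma> \<in> weyl_group r E" "v \<in> simple_roots r E"
  shows "weyl_length r E (\<sigma> \<circ> reflection r v) \<le> Suc (weyl_length r E \<sigma>)"
proof -
  obtain vs where vs: "set vs \<subseteq> simple_roots r E" "length vs = weyl_length r E \<sigma>" "root_word r vs = \<sigma>"
    using reduced_word_exists[OF assms(1)] by blast
  with assms(2) have "weyl_length r E (root_word r (vs @ [v])) \<le> length (vs @ [v])"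
    by (intro weyl_length_le) auto
  with vs show ?thesis by (simp add: root_word_append)
qed

text \<open>The last letter of a reduced word is split off, the one next to the argument, so that
  \<sigma> applied to a class is \<tau> of that class plus a multiple of \<tau> applied to
  \<open>u\<close>.\<close>

lemma weyl_length_decompose:
  assumes "\<sigma> \<in> weyl_group r E" "\<sigma> \<noteq> id"
  obtains \<tau> u where "\<tau> \<in> weyl_group r E" "u \<in> simple_roots r E" "\<sigma> = \<tau> \<circ> reflection r u"
    "weyl_length r E \<tau> < weyl_length r E \<sigma>"
proof -
  obtain vs where vs: "set vs \<subseteq> simple_roots r E" "length vs = weyl_length r E \<sigma>" "root_word r vs = \<sigma>"
    using reduced_word_exists[OF assms(1)] by blast
  with assms(2) have "vs \<noteq> []" by auto
  then obtain us u where us: "vs = us @ [u]" by (metis append_butlast_last_id)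
  show thesis
  proof (rule that[of "root_word r us" u])
    show "weyl_length r E (root_word r us) < weyl_length r E \<sigma>"
      using vs us weyl_length_le[of us r E] by auto
  qed (use vs us in \<open>auto simp: root_word_append intro: root_word_in_weyl_group\<close>)
qed

text \<open>Tits' argument for Coxeter groups: \<open>\<sigma>\<close> is shortened within the dihedral group generated by its last
  reflection and that of \<open>v\<close>, which has order \<open>4\<close> or \<open>6\<close> here.\<close>

lemma weyl_image_of_simple_root_nonneg:
  assumes E: "lorentz_frame r E" and H: "dominant r E H"
    and "\<sigma> \<in> weyl_group r E" "v \<in> simple_roots r E"
    and "weyl_length r E \<sigma> \<le> weyl_length r E (\<sigma> \<circ> reflection r v)"
  shows "0 \<le> intersection r H (\<sigma> v)"
  using assms(3-5)
proof (induction "weyl_length r E \<sigma>" arbitrary: \<sigma> v rule: less_induct)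
  case less
  let ?l = "weyl_length r E" and ?s = "reflection r"
  note sq = simple_root_square[OF E]
  show ?case
  proof (cases "\<sigma> = id")
    case True
    then show ?thesis using H less.prems by (simp add: dominant_def)
  next
    case False
    then obtain \<tau> u where \<tau>: "\<tau> \<in> weyl_group r E" and u: "u \<in> simple_roots r E"
      and \<sigma>: "\<sigma> = \<tau> \<circ> ?s u" and len: "?l \<tau> < ?l \<sigma>"
      using weyl_length_decompose[OF less.prems(1)] by metis
    have v: "v \<in> simple_roots r E" by fact
    have uu: "?s u \<circ> ?s u = id" using sq[OF u] by (rule reflection_involution)
    have "u \<noteq> v"
    proof
      assume "u = v"
      then have "\<sigma> \<circ> ?s v = \<tau>" using uu by (simp add: \<sigma> comp_assoc)
      with less.prems len show False by simp
    qed
    \<comment> \<open>Appending \<open>?s u\<close> to \<tau> gives the longer \<sigma>, so the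
      induction hypothesis covers the pair \<tau>, \<open>u\<close>.\<close>
    have \<tau>u: "0 \<le> intersection r H (\<tau> u)"
      using len by (intro less.hyps \<tau> u) (simp_all add: \<sigma>)
    consider "intersection r v u = 0" | "intersection r v u = 1"
      using simple_root_product[OF E v u] \<open>u \<noteq> v\<close> by blast
    then show ?thesis
    proof cases
      case 1
      \<comment> \<open>If \<open>?s v\<close> shortened \<tau>, commuting the two reflections would
        make \<open>\<sigma> \<circ> ?s v\<close> no longer than \<tau>, hence shorter than
        \<sigma>.\<close>
      have "?l \<tau> \<le> ?l (\<tau> \<circ> ?s v)"
      proof (rule ccontr)
        assume "\<not> ?thesis"
        moreover have "\<sigma> \<circ> ?s v = \<tau> \<circ> ?s v \<circ> ?s u"
          using reflection_commute[of r v u] 1 by (simp add: \<sigma> comp_assoc)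
        moreover have "?l (\<tau> \<circ> ?s v \<circ> ?s u) \<le> Suc (?l (\<tau> \<circ> ?s v))"
          using \<tau> v u by (intro weyl_length_comp_reflection weyl_group_comp reflection_in_weyl_group)
        ultimately show False using less.prems len by simp
      qed
      then have "0 \<le> intersection r H (\<tau> v)"
        using len \<tau> v by (intro less.hyps)
      moreover have "\<sigma> v = \<tau> v" using 1 by (simp add: \<sigma> reflection_def)
      ultimately show ?thesis by simp
    next
      case 2
      have \<sigma>v: "\<sigma> v = (\<lambda>k. \<tau> v k + \<tau> u k)"
        using 2 weyl_group_linear[OF \<tau>, of v 1 u] by (simp add: \<sigma> reflection_def)
      show ?thesis
      proof (cases "?l \<tau> \<le> ?l (\<tau> \<circ> ?s v)")
        case True
        then have "0 \<le> intersection r H (\<tau> v)"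
          using len \<tau> v by (intro less.hyps)
        with \<tau>u \<sigma>v show ?thesis by simp
      next
        case False
        \<comment> \<open>When \<open>?s v\<close> shortens \<tau>, the hypothesis is applied to
          \<rho> and \<open>u\<close> instead: \<open>\<rho> u\<close> and \<open>\<sigma> v\<close>
          are both \<tau> of the sum of \<open>u\<close> and \<open>v\<close>.\<close>
        define \<rho> where "\<rho> = \<tau> \<circ> ?s v"
        have \<rho>: "\<rho> \<in> weyl_group r E"
          using \<tau> v by (auto simp: \<rho>_def intro: weyl_group_comp reflection_in_weyl_group)
        have len\<rho>: "?l \<rho> < ?l \<tau>" using False by (simp add: \<rho>_def)
        have vv: "?s v \<circ> ?s v = id" using sq[OF v] by (rule reflection_involution)
        have \<tau>\<rho>: "\<tau> = \<rho> \<circ> ?s v" using vv by (simp add: \<rho>_def comp_assoc)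
        have "?l \<rho> \<le> ?l (\<rho> \<circ> ?s u)"
        proof (rule ccontr)
          assume neg: "\<not> ?thesis"
          \<comment> \<open>The braid relation lets the three letters after \<rho> begin with
            \<open>?s u\<close>. If that one shortened \<rho>, the whole word would be no longer
            than \<tau>.\<close>
          have "\<sigma> \<circ> ?s v = \<rho> \<circ> (?s v \<circ> ?s u \<circ> ?s v)"
            by (simp add: \<sigma> \<tau>\<rho> comp_assoc)
          also have "\<dots> = \<rho> \<circ> ?s u \<circ> ?s v \<circ> ?s u"
            using reflection_braid[OF sq[OF v] sq[OF u] 2] by (simp add: comp_assoc)
          finally have eq: "\<sigma> \<circ> ?s v = \<rho> \<circ> ?s u \<circ> ?s v \<circ> ?s u" .
          have "?l (\<rho> \<circ> ?s u \<circ> ?s v \<circ> ?s u) \<le> Suc (?l (\<rho> \<circ> ?s u \<circ> ?s v))"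
            using \<rho> v u by (intro weyl_length_comp_reflection weyl_group_comp reflection_in_weyl_group)
          moreover have "?l (\<rho> \<circ> ?s u \<circ> ?s v) \<le> Suc (?l (\<rho> \<circ> ?s u))"
            using \<rho> v u by (intro weyl_length_comp_reflection weyl_group_comp reflection_in_weyl_group)
          ultimately show False using less.prems len len\<rho> neg eq by simp
        qed
        then have "0 \<le> intersection r H (\<rho> u)"
          using len len\<rho> \<rho> u by (intro less.hyps) auto
        moreover have "\<rho> u = \<sigma> v"
          using 2 weyl_group_linear[OF \<tau>, of u 1 v]
          by (simp add: \<sigma>v \<rho>_def reflection_def intersection_commute[of r u v] add.commute)
        ultimately show ?thesis by simp
      qed
    qed
  qed
qed

theorem dominant_minimal_in_orbit:
  assumes E: "lorentz_frame r E" and H: "dominant r E H" and D: "dominant r E D"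
    and "\<sigma> \<in> weyl_group r E"
  shows "intersection r H D \<le> intersection r H (\<sigma> D)"
  using assms(4)
proof (induction "weyl_length r E \<sigma>" arbitrary: \<sigma> rule: less_induct)
  case less
  show ?case
  proof (cases "\<sigma> = id")
    case False
    then obtain \<tau> u where \<tau>: "\<tau> \<in> weyl_group r E" and u: "u \<in> simple_roots r E"
      and \<sigma>: "\<sigma> = \<tau> \<circ> reflection r u" and len: "weyl_length r E \<tau> < weyl_length r E \<sigma>"
      using weyl_length_decompose[OF less.prems] by metis
    have "0 \<le> intersection r H (\<tau> u)"
      using len by (intro weyl_image_of_simple_root_nonneg[OF E H \<tau> u]) (simp add: \<sigma>)
    moreover have "0 \<le> intersection r D u" using D u by (simp add: dominant_def)
    moreover have "\<sigma> D = (\<lambda>k. \<tau> D k + intersection r D u * \<tau> u k)"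
      using weyl_group_linear[OF \<tau>] by (simp add: \<sigma> reflection_def)
    ultimately show ?thesis using less.hyps[OF len \<tau>]
      by (simp add: add_increasing2)
  qed simp
qed

section \<open>The standard basis and the orbit of the exceptional curves\<close>

abbreviation std_frame :: "nat \<Rightarrow> divisor_class" where
  "std_frame \<equiv> blowup_exceptional_class"

lemma intersection_std_frame:
  "i \<le> r \<Longrightarrow> intersection r x (std_frame i) = (if i = 0 then x 0 else - x i)"
  by (simp add: intersection_def blowup_exceptional_class_def if_distrib[of "(*) _"] cong: if_cong)

lemma lorentz_frame_std: "lorentz_frame r std_frame"
  by (auto simp: lorentz_frame_def intersection_std_frame) (auto simp: blowup_exceptional_class_def)

lemma intersection_canonical:
  "intersection r x (canonical_class r) = -3 * x 0 - (\<Sum>i=1..r. x i)"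
  by (simp add: intersection_def canonical_class_def)

lemma weyl_group_canonical:
  assumes "\<sigma> \<in> weyl_group r std_frame"
  shows "\<sigma> (canonical_class r) = canonical_class r"
  using assms
proof induction
  case (weyl_step \<sigma> v)
  have "intersection r (canonical_class r) v = 0"
    using weyl_step.hyps(2)
    by (auto simp: simple_roots_def intersection_std_frame canonical_class_def)
  with weyl_step show ?case by (simp add: reflection_def)
qed simp

lemma weyl_group_support:
  assumes "\<sigma> \<in> weyl_group r std_frame" "\<And>k. r < k \<Longrightarrow> x k = 0" "r < k"
  shows "\<sigma> x k = 0"
  using assms(1)
proof induction
  case (weyl_step \<sigma> v)
  have "v k = 0"
    using weyl_step.hyps(2) assms(3) by (auto simp: simple_roots_def blowup_exceptional_class_def)
  with weyl_step show ?case by (simp add: reflection_def)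
qed (use assms in simp)

text \<open>Adjacent transpositions carry \<open>std_frame j\<close> down to place \<open>i\<close>.
  Keeping the earlier members fixed allows a configuration to be put in order one member at a
  time.\<close>

lemma move_std_frame:
  assumes "1 \<le> i" "i \<le> j" "j \<le> r"
  shows "\<exists>\<sigma>\<in>weyl_group r std_frame. \<sigma> (std_frame j) = std_frame i \<and>
    (\<forall>l<i. \<sigma> (std_frame l) = std_frame l)"
  using assms(2,3)
proof (induction j rule: dec_induct)
  case base
  show ?case by (intro bexI[of _ id]) (auto intro: weyl_id)
next
  case (step j)
  then obtain \<sigma> where \<sigma>: "\<sigma> \<in> weyl_group r std_frame" "\<sigma> (std_frame j) = std_frame i"
    "\<forall>l<i. \<sigma> (std_frame l) = std_frame l" by auto
  let ?v = "\<lambda>k. std_frame j k - std_frame (j + 1) k"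
  have v: "?v \<in> simple_roots r std_frame"
    unfolding simple_roots_def using step.hyps step.prems assms(1)
    by (intro UnI2 CollectI exI[of _ j]) auto
  have I: "intersection r (std_frame l) ?v = (if l = j then -1 else if l = Suc j then 1 else 0)"
    if "l \<le> r" for l
    using step assms(1) that
    by (auto simp: intersection_std_frame) (auto simp: blowup_exceptional_class_def)
  have 1: "reflection r ?v (std_frame (Suc j)) = std_frame j"
    using I[of "Suc j"] step by (simp add: reflection_def)
  have 2: "reflection r ?v (std_frame l) = std_frame l" if "l < i" for l
    using I[of l] step that by (simp add: reflection_def)
  show ?case
    using \<sigma> 1 2 v
    by (intro bexI[of _ "\<sigma> \<circ> reflection r ?v"] weyl_group_comp reflection_in_weyl_group) auto
qed

text \<open>The degree is the product with \<open>std_frame 0\<close>, which is dominant. Among the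
  exceptional curves \<open>std_frame r\<close> is the dominant one and the others lie in its orbit,
  so minimality over the orbit bounds the degree below by the product of these two classes, which is
  0.\<close>

lemma weyl_image_degree_nonneg:
  assumes "\<sigma> \<in> weyl_group r std_frame" "i \<in> {1..r}"
  shows "0 \<le> \<sigma> (std_frame i) 0"
proof -
  let ?W = "weyl_group r std_frame"
  obtain \<tau> where \<tau>: "\<tau> \<in> ?W" "\<tau> (std_frame r) = std_frame i"
    using move_std_frame[of i r r] assms(2) by auto
  have "dominant r std_frame (std_frame 0)"
    by (auto simp: dominant_def simple_roots_def intersection_std_frame)
       (auto simp: blowup_exceptional_class_def)
  moreover have "dominant r std_frame (std_frame r)"
    using assms(2) by (auto simp: dominant_def simple_roots_def intersection_std_frame)
       (auto simp: blowup_exceptional_class_def)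
  ultimately have "intersection r (std_frame 0) (std_frame r) \<le>
      intersection r (std_frame 0) ((\<sigma> \<circ> \<tau>) (std_frame r))"
    using weyl_group_comp[OF assms(1) \<tau>(1)] lorentz_frame_std by (intro dominant_minimal_in_orbit)
  then have "intersection r (std_frame 0) (std_frame r) \<le> intersection r (\<sigma> (std_frame i)) (std_frame 0)"
    by (simp add: \<tau> intersection_commute)
  then show ?thesis
    using assms(2) by (auto simp: intersection_std_frame) (auto simp: blowup_exceptional_class_def)
qed

text \<open>Nefness is tested on numerical classes, not on curves: they include all Weyl translates
  of exceptional curves, and their effectivity follows by counting coefficients.\<close>

definition exceptionally_nef :: "nat \<Rightarrow> divisor_class \<Rightarrow> bool" where
  "exceptionally_nef r F \<longleftrightarrow> (\<forall>x. (\<forall>k>r. x k = 0) \<and> intersection r x x = -1 \<and>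
     intersection r x (canonical_class r) = -1 \<and> 0 \<le> x 0 \<longrightarrow> 0 \<le> intersection r F x)"

section \<open>Noether's inequality and descent to the class of a line\<close>

lemma square_sum_bound:
  fixes p q d :: int
  assumes "p + q = 3 * (d - 1)" "p * p + q * q = d * d - 1" "1 \<le> d"
  shows "d = 1"
proof (rule ccontr)
  assume "d \<noteq> 1"
  define D where "D = d - 1"
  have D: "1 \<le> D" "d = D + 1" using \<open>d \<noteq> 1\<close> assms(3) by (auto simp: D_def)
  \<comment> \<open>Cauchy-Schwarz in two variables; in terms of \<open>D\<close> it becomes
    \<open>7 D^2 \<le> 4 D\<close>, impossible for \<open>D \<ge> 1\<close>.\<close>
  have "(p + q) * (p + q) \<le> 2 * (p * p + q * q)"
    using zero_le_square[of "p - q"] by (simp add: algebra_simps)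
  then have "9 * (D * D) \<le> 2 * (D * D) + 4 * D"
    unfolding assms(1,2) D(2) by (simp add: algebra_simps)
  moreover have "D \<le> D * D" using D(1) by (simp add: mult_le_cancel_left1)
  ultimately show False using D(1) by linarith
qed

text \<open>With \<open>c = m 3\<close>, the combination \<Sum> \<open>m i (m i - c)\<close> of the
  two equations gets nothing positive from the third point on. Bounding the first two terms by
  \<open>m 1 + m 2 + m 3 \<le> d\<close> forces \<open>3 c \<le> 1\<close>; so at most two points
  carry a multiplicity, and \<open>square_sum_bound\<close> applies.\<close>

lemma Noether_inequality:
  fixes d :: int and m :: "nat \<Rightarrow> int"
  assumes nonneg: "\<And>i. i \<in> {1..r} \<Longrightarrow> 0 \<le> m i"
    and mono: "\<And>i. 1 \<le> i \<Longrightarrow> i < r \<Longrightarrow> m (i + 1) \<le> m i"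
    and three: "3 \<le> r \<Longrightarrow> m 1 + m 2 + m 3 \<le> d"
    and square: "d * d - (\<Sum>i=1..r. m i * m i) = 1"
    and degree: "3 * d - (\<Sum>i=1..r. m i) = 3"
  shows "d = 1"
proof -
  have "0 \<le> (\<Sum>i=1..r. m i)" using nonneg by (intro sum_nonneg) auto
  then have d: "1 \<le> d" using degree by linarith
  consider "r = 0" | "r = 1" | "r = 2" | "3 \<le> r" by linarith
  then show ?thesis
  proof cases
    case 1
    then show ?thesis using degree by simp
  next
    case 2
    then show ?thesis using square degree d square_sum_bound[of "m 1" 0 d] by simp
  next
    case 3
    then have "{1..r} = {1, 2}" by auto
    then show ?thesis using square degree d square_sum_bound[of "m 1" "m 2" d] by simp
  next
    case 4
    define c where "c = m 3"
    have split: "{1..r} = insert 1 (insert 2 {3..r})" using 4 by auto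
    have sum_split: "(\<Sum>i=1..r. f i) = f 1 + f 2 + (\<Sum>i=3..r. f i)" for f :: "nat \<Rightarrow> int"
      unfolding split by simp
    have le: "m i \<le> c" if "3 \<le> i" "i \<le> r" for i
      using that
    proof (induction i rule: dec_induct)
      case (step i)
      then show ?case using mono[of i] by simp
    qed (simp add: c_def)
    have c0: "0 \<le> c" using nonneg[of 3] 4 by (simp add: c_def)
    \<comment> \<open>Excesses over \<open>c\<close>, in which the condition on three points reads
      \<open>p + q + 3 c \<le> d\<close>.\<close>
    define p q where "p = m 1 - c" and "q = m 2 - c"
    have p: "0 \<le> q" "q \<le> p" using mono[of 1] mono[of 2] 4
      by (auto simp: p_def q_def c_def numeral_2_eq_2 numeral_3_eq_3)
    have pq: "p + q + 3 * c \<le> d" using three 4 by (simp add: p_def q_def c_def)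
    have "(\<Sum>i=3..r. m i * (m i - c)) \<le> 0"
      using le nonneg by (intro sum_nonpos mult_nonneg_nonpos) auto
    then have "(\<Sum>i=1..r. m i * (m i - c)) \<le> (p + c) * p + (q + c) * q"
      unfolding sum_split by (simp add: p_def q_def)
    moreover have "(\<Sum>i=1..r. m i * (m i - c)) = (d * d - 1) - c * (3 * d - 3)"
    proof -
      have "(\<Sum>i=1..r. m i * (m i - c)) = (\<Sum>i=1..r. m i * m i) - (\<Sum>i=1..r. m i) * c"
        by (simp add: right_diff_distrib sum_subtractf sum_distrib_right)
      also have "(\<Sum>i=1..r. m i * m i) = d * d - 1" using square by simp
      also have "(\<Sum>i=1..r. m i) = 3 * d - 3" using degree by simp
      finally show ?thesis by (simp add: mult.commute)
    qed
    moreover have "(p + c) * p + (q + c) * q \<le> (p + q + c) * (p + q)"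
      using p c0 mult_nonneg_nonneg[of p q] by (simp add: algebra_simps)
    moreover have "(p + q + c) * (p + q) \<le> (d - 2 * c) * (d - 3 * c)"
      using pq p c0 by (intro mult_mono) auto
    moreover have "c * (3 * c) \<le> c * d" using pq p c0 by (intro mult_left_mono) auto
    \<comment> \<open>The terms \<open>d * d\<close> cancel, and
      \<open>3 c - 1 \<le> 2 c (3 c - d) \<le> 0\<close> remains.\<close>
    ultimately have "3 * c \<le> 1" by (simp add: algebra_simps)
    with c0 have "c = 0" by simp
    then have "m i = 0" if "i \<in> {3..r}" for i
      using le[of i] nonneg[of i] that by auto
    then show ?thesis using square degree d square_sum_bound[of "m 1" "m 2" d]
      unfolding sum_split by simp
  qed
qed

lemma nef_class_in_line_orbit:
  assumes nef: "exceptionally_nef r F" and support: "\<And>k. r < k \<Longrightarrow> F k = 0"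
    and square: "intersection r F F = 1" and canonical: "intersection r F (canonical_class r) = -3"
  shows "\<exists>\<sigma>\<in>weyl_group r std_frame. \<sigma> F = std_frame 0"
proof -
  let ?W = "weyl_group r std_frame"
  note frame = lorentz_frame_std[of r]
  \<comment> \<open>A tie-breaker for equal degrees, the sum of index times multiplicity: it drops
    when a transposition moves the larger of two adjacent multiplicities to the smaller
    index.\<close>
  define G where "G = (\<lambda>y :: divisor_class. \<Sum>i=1..r. int i * - y i)"
  \<comment> \<open>The multiplicity \<open>- \<sigma> F i\<close> is the product of
    \<open>F\<close> with the preimage of \<open>std_frame i\<close> under \<sigma>, one of the test
    classes of \<open>exceptionally_nef\<close>.\<close>
  have coord: "\<sigma> F i \<le> 0" if \<sigma>: "\<sigma> \<in> ?W" and i: "i \<in> {1..r}" for \<sigma> i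
  proof -
    obtain \<tau> where \<tau>: "\<tau> \<in> ?W" "\<sigma> \<circ> \<tau> = id"
      using weyl_group_inverse[OF frame \<sigma>] by blast
    define x where "x = \<tau> (std_frame i)"
    have "intersection r x x = -1"
      using i by (simp add: x_def weyl_group_isometry[OF frame \<tau>(1)] intersection_std_frame)
        (simp add: blowup_exceptional_class_def)
    moreover have "intersection r x (canonical_class r) = -1"
    proof -
      have "intersection r x (canonical_class r) = intersection r (std_frame i) (canonical_class r)"
        using weyl_group_isometry[OF frame \<tau>(1), of "std_frame i" "canonical_class r"]
        by (simp add: x_def weyl_group_canonical[OF \<tau>(1)])
      then show ?thesis
        using i by (simp add: intersection_commute[of r "std_frame i"] intersection_std_frame canonical_class_def)
    qed
    moreover have "x k = 0" if "r < k" for k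
      unfolding x_def using that i
      by (intro weyl_group_support[OF \<tau>(1)]) (auto simp: blowup_exceptional_class_def)
    moreover have "0 \<le> x 0" unfolding x_def using weyl_image_degree_nonneg[OF \<tau>(1) i] .
    ultimately have "0 \<le> intersection r F x" using nef by (simp add: exceptionally_nef_def)
    also have "\<dots> = intersection r (\<sigma> F) (\<sigma> x)" by (simp add: weyl_group_isometry[OF frame \<sigma>])
    also have "\<sigma> x = std_frame i" using \<tau>(2) by (simp add: x_def fun_eq_iff)
    finally show ?thesis using i by (simp add: intersection_std_frame)
  qed
  have sq: "intersection r (\<sigma> F) (\<sigma> F) = 1" and can: "intersection r (\<sigma> F) (canonical_class r) = -3"
    if \<sigma>: "\<sigma> \<in> ?W" for \<sigma>
    using square canonical weyl_group_isometry[OF frame \<sigma>, of F] weyl_group_canonical[OF \<sigma>]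
    by metis+
  have deg: "1 \<le> \<sigma> F 0" if \<sigma>: "\<sigma> \<in> ?W" for \<sigma>
  proof -
    have "(\<Sum>i=1..r. \<sigma> F i) \<le> 0" using coord[OF \<sigma>] by (intro sum_nonpos) auto
    with can[OF \<sigma>] show ?thesis by (simp add: intersection_canonical)
  qed
  have G0: "0 \<le> G (\<sigma> F)" if \<sigma>: "\<sigma> \<in> ?W" for \<sigma>
    unfolding G_def using coord[OF \<sigma>] by (intro sum_nonneg mult_nonneg_nonneg) auto
  \<comment> \<open>The orbit is minimised first by degree, then by \<open>G\<close>. Both are
    nonnegative on it, so \<open>nat\<close> does not distort the order.\<close>
  obtain \<sigma> where \<sigma>: "\<sigma> \<in> ?W" and least: "\<And>\<tau>. (\<tau>, \<sigma>) \<in>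
      measures [\<lambda>\<sigma>. nat (\<sigma> F 0), \<lambda>\<sigma>. nat (G (\<sigma> F))] \<Longrightarrow> \<tau> \<notin> ?W"
    using wfE_min[OF wf_measures, of id ?W] weyl_id by metis
  define y where "y = \<sigma> F"
  have "0 \<le> intersection r y v" if v: "v \<in> simple_roots r std_frame" for v
  proof (rule ccontr)
    assume neg: "\<not> ?thesis"
    define c where "c = intersection r y v"
    define \<tau> where "\<tau> = reflection r v \<circ> \<sigma>"
    have \<tau>: "\<tau> \<in> ?W" unfolding \<tau>_def using \<sigma> v by (rule weyl_step)
    have \<tau>F: "\<tau> F = (\<lambda>k. y k + c * v k)" by (simp add: \<tau>_def reflection_def y_def c_def)
    have c: "c < 0" using neg by (simp add: c_def)
    \<comment> \<open>Reflecting adds \<open>c < 0\<close> times the root: the quadratic root lowers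
      the degree, a difference root keeps it and lowers \<open>G\<close>.\<close>
    have "v 0 = 1 \<or> v 0 = 0 \<and> G v = 1"
    proof -
      have "v 0 = 0 \<and> G v = 1"
        if i: "1 \<le> i" "i < r" and "v = (\<lambda>k. std_frame i k - std_frame (i + 1) k)" for i
      proof -
        have "G v = (\<Sum>k=1..r. (if k = i + 1 then int k else 0) - (if k = i then int k else 0))"
          unfolding G_def that(3) by (intro sum.cong) (auto simp: blowup_exceptional_class_def)
        also have "\<dots> = 1" using i by (simp add: sum_subtractf)
        finally show ?thesis using that by (simp add: blowup_exceptional_class_def)
      qed
      then show ?thesis using v by (auto simp: simple_roots_def blowup_exceptional_class_def)
    qed
    moreover have "G (\<tau> F) = G y + c * G v"
      by (simp add: \<tau>F G_def ring_distribs sum.distrib sum_negf sum_subtractf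
          sum_distrib_left mult.left_commute)
    ultimately have "\<tau> F 0 < y 0 \<or> \<tau> F 0 = y 0 \<and> G (\<tau> F) < G y"
      using c by (auto simp: \<tau>F)
    then have "(\<tau>, \<sigma>) \<in> measures [\<lambda>\<sigma>. nat (\<sigma> F 0), \<lambda>\<sigma>. nat (G (\<sigma> F))]"
      using deg[OF \<tau>] deg[OF \<sigma>] G0[OF \<tau>] G0[OF \<sigma>] by (auto simp: y_def)
    with least \<tau> show False by blast
  qed
  note dom = this
  have "y 0 = 1"
  proof (rule Noether_inequality[of r "\<lambda>i. - y i"])
    show "0 \<le> - y i" if "i \<in> {1..r}" for i using coord[OF \<sigma> that] by (simp add: y_def)
    show "- y (i + 1) \<le> - y i" if "1 \<le> i" "i < r" for i
    proof -
      have "(\<lambda>k. std_frame i k - std_frame (i + 1) k) \<in> simple_roots r std_frame"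
        using that by (auto simp: simple_roots_def)
      from dom[OF this] that show ?thesis by (simp add: intersection_std_frame)
    qed
    show "- y 1 + - y 2 + - y 3 \<le> y 0" if "3 \<le> r"
    proof -
      have "(\<lambda>k. std_frame 0 k - std_frame 1 k - std_frame 2 k - std_frame 3 k) \<in> simple_roots r std_frame"
        using that by (auto simp: simple_roots_def)
      from dom[OF this] that show ?thesis by (simp add: intersection_std_frame)
    qed
    show "y 0 * y 0 - (\<Sum>i=1..r. - y i * - y i) = 1"
      using sq[OF \<sigma>] by (simp add: y_def intersection_def)
    show "3 * y 0 - (\<Sum>i=1..r. - y i) = 3"
      using can[OF \<sigma>] by (simp add: y_def intersection_canonical sum_negf)
  qed
  moreover from this have "(\<Sum>i=1..r. y i * y i) = 0"
    using sq[OF \<sigma>] by (simp add: y_def intersection_def)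
  then have "\<forall>i\<in>{1..r}. y i = 0" by (subst (asm) sum_nonneg_eq_0_iff) auto
  moreover have "y k = 0" if "r < k" for k
    using weyl_group_support[OF \<sigma> support that] by (simp add: y_def)
  ultimately have "y = std_frame 0"
    by (intro ext) (metis One_nat_def Suc_leI atLeastAtMost_iff blowup_exceptional_class_def not_gr0 not_le)
  then show ?thesis using \<sigma> by (auto simp: y_def)
qed

text \<open>The coordinates and their squares both sum to 1, and \<open>n (n - 1)\<close> is never
  negative on integers. Hence every coordinate is 0 or 1, and exactly one is 1.\<close>

lemma exceptional_class_orthogonal_to_line:
  assumes "z 0 = 0" "intersection r z z = -1" "intersection r z (canonical_class r) = -1"
    "\<And>k. r < k \<Longrightarrow> z k = 0"
  shows "\<exists>j\<in>{1..r}. z = std_frame j"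
proof -
  have sq: "(\<Sum>i=1..r. z i * z i) = 1" using assms(1,2) by (simp add: intersection_def)
  have lin: "(\<Sum>i=1..r. z i) = 1" using assms(1,3) by (simp add: intersection_canonical)
  have "0 \<le> z i * (z i - 1)" for i
    by (cases "1 \<le> z i") (auto simp: mult_nonpos_nonpos)
  moreover have "(\<Sum>i=1..r. z i * (z i - 1)) = 0"
    using sq lin by (simp add: right_diff_distrib sum_subtractf)
  ultimately have "\<forall>i\<in>{1..r}. z i * (z i - 1) = 0"
    by (subst (asm) sum_nonneg_eq_0_iff) auto
  then have z01: "z i = 0 \<or> z i = 1" if "i \<in> {1..r}" for i using that by auto
  obtain j where j: "j \<in> {1..r}" "z j = 1"
  proof (rule ccontr)
    assume "\<not> thesis"
    then have "\<forall>i\<in>{1..r}. z i = 0" using z01 that by blast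
    with lin show False by simp
  qed
  have "(\<Sum>i\<in>{1..r} - {j}. z i) = 0"
    using lin j sum.remove[of "{1..r}" j z] by simp
  then have "\<forall>i\<in>{1..r} - {j}. z i = 0"
    using z01 by (subst (asm) sum_nonneg_eq_0_iff) fastforce+
  then have "z k = 0" if "k \<noteq> j" for k
    using assms(1) assms(4)[of k] that by (cases "k = 0 \<or> r < k") auto
  then have "z = std_frame j" using j(2) by (auto simp: blowup_exceptional_class_def)
  then show ?thesis using j(1) by blast
qed

lemma effective_irreducible_class_support:
  "effective_irreducible_class r s t C \<Longrightarrow> r < k \<Longrightarrow> C k = 0"
  by (auto simp: effective_irreducible_class_def blowup_exceptional_class_def proper_transform_class_def)

text \<open>Members are put in place successively. The next one is orthogonal to the line, hence
  some \<open>std_frame j\<close>; orthogonality to those already placed puts \<open>j\<close>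
  beyond them, so it can be moved without disturbing them.\<close>

lemma exceptional_configuration_in_orbit:
  assumes F: "exceptional_configuration r s t F" and nef: "exceptionally_nef r (F 0)"
  shows "\<exists>\<sigma>\<in>weyl_group r std_frame. \<forall>i\<le>r. F i = \<sigma> (std_frame i)"
proof -
  let ?W = "weyl_group r std_frame"
  note frame = lorentz_frame_std[of r]
  have support: "F i k = 0" if "i \<le> r" "r < k" for i k
    using F that effective_irreducible_class_support[of r s t "F i" k]
    by (auto simp: exceptional_configuration_def)
  have "\<exists>\<sigma>\<in>?W. \<forall>i\<le>n. \<sigma> (F i) = std_frame i" if "n \<le> r" for n
    using that
  proof (induction n)
    case 0
    have "\<exists>\<sigma>\<in>?W. \<sigma> (F 0) = std_frame 0"
      using F nef support[of 0] by (intro nef_class_in_line_orbit) (auto simp: exceptional_configuration_def)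
    then show ?case by simp
  next
    case (Suc n)
    then obtain \<sigma> where \<sigma>: "\<sigma> \<in> ?W" and \<sigma>F: "\<And>i. i \<le> n \<Longrightarrow> \<sigma> (F i) = std_frame i" by auto
    define z where "z = \<sigma> (F (Suc n))"
    have zF: "intersection r z (std_frame i) = 0" if "i \<le> n" for i
    proof -
      have "intersection r z (std_frame i) = intersection r (F (Suc n)) (F i)"
        using \<sigma>F[OF that] weyl_group_isometry[OF frame \<sigma>] by (metis z_def)
      then show ?thesis using F that Suc.prems by (auto simp: exceptional_configuration_def)
    qed
    have "\<exists>j\<in>{1..r}. z = std_frame j"
    proof (rule exceptional_class_orthogonal_to_line)
      show "z 0 = 0" using zF[of 0] by (simp add: intersection_std_frame)
      show "intersection r z z = -1"
        using F Suc.prems by (simp add: z_def weyl_group_isometry[OF frame \<sigma>] exceptional_configuration_def)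
      have "intersection r z (canonical_class r) = intersection r (F (Suc n)) (canonical_class r)"
        using weyl_group_isometry[OF frame \<sigma>] weyl_group_canonical[OF \<sigma>] by (metis z_def)
      then show "intersection r z (canonical_class r) = -1"
        using F Suc.prems by (simp add: exceptional_configuration_def)
      show "z k = 0" if "r < k" for k
        using weyl_group_support[OF \<sigma> support that] Suc.prems that by (simp add: z_def)
    qed
    then obtain j where j: "1 \<le> j" "j \<le> r" "z = std_frame j" by auto
    have "Suc n \<le> j"
    proof (rule ccontr)
      assume "\<not> ?thesis"
      then have "z j = 0" using zF[of j] j by (simp add: intersection_std_frame)
      with j show False by (simp add: blowup_exceptional_class_def)
    qed
    then obtain \<tau> where \<tau>: "\<tau> \<in> ?W" "\<tau> (std_frame j) = std_frame (Suc n)"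
      "\<forall>l<Suc n. \<tau> (std_frame l) = std_frame l"
      using move_std_frame[of "Suc n" j r] j by auto
    have "(\<tau> \<circ> \<sigma>) (F i) = std_frame i" if "i \<le> Suc n" for i
      using that \<tau> \<sigma>F j(3) by (cases "i = Suc n") (auto simp: z_def)
    then show ?case using weyl_group_comp[OF \<tau>(1) \<sigma>] by blast
  qed
  then obtain \<sigma> where \<sigma>: "\<sigma> \<in> ?W" "\<And>i. i \<le> r \<Longrightarrow> \<sigma> (F i) = std_frame i" by blast
  obtain \<tau> where \<tau>: "\<tau> \<in> ?W" "\<tau> \<circ> \<sigma> = id" using weyl_group_inverse[OF frame \<sigma>(1)] by blast
  then show ?thesis using \<sigma>(2) pointfree_idE[OF \<tau>(2)] by metis
qed

section \<open>Change of exceptional configuration\<close>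

lemma weyl_group_diff:
  "\<sigma> \<in> weyl_group r E \<Longrightarrow> \<sigma> (\<lambda>k. x k - y k) = (\<lambda>k. \<sigma> x k - \<sigma> y k)"
  using weyl_group_linear[of \<sigma> r E x "-1" y] by simp

lemma weyl_group_sum:
  assumes "\<sigma> \<in> weyl_group r E" "finite I"
  shows "\<sigma> (\<lambda>k. \<Sum>i\<in>I. c i * x i k) = (\<lambda>k. \<Sum>i\<in>I. c i * \<sigma> (x i) k)"
  using assms(2)
proof induction
  case empty
  show ?case using weyl_group_diff[OF assms(1), of "\<lambda>k. 0" "\<lambda>k. 0"] by simp
next
  case (insert j I)
  then show ?case
    using weyl_group_linear[OF assms(1), of "\<lambda>k. \<Sum>i\<in>I. c i * x i k" "c j" "x j"]
    by (simp add: add.commute)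
qed

lemma weyl_group_class_of:
  assumes "\<sigma> \<in> weyl_group r E" "\<And>i. i \<le> r \<Longrightarrow> A i = \<sigma> (B i)"
  shows "class_of r A d m = \<sigma> (class_of r B d m)"
proof -
  have "\<sigma> (class_of r B d m) = (\<lambda>k. \<sigma> (\<lambda>k. d * B 0 k) k - (\<Sum>i=1..r. m i * \<sigma> (B i) k))"
    unfolding class_of_def weyl_group_diff[OF assms(1)] by (simp add: weyl_group_sum[OF assms(1)])
  also have "\<sigma> (\<lambda>k. d * B 0 k) = (\<lambda>k. d * \<sigma> (B 0) k)"
    using weyl_group_sum[OF assms(1), of "{0}" "\<lambda>_. d" B] by simp
  finally show ?thesis using assms(2) by (simp add: class_of_def)
qed

lemma simple_roots_image:
  assumes "\<sigma> \<in> weyl_group r E" "\<And>i. i \<le> r \<Longrightarrow> A i = \<sigma> (B i)"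
  shows "simple_roots r A = \<sigma> ` simple_roots r B"
proof -
  have 1: "{v. 3 \<le> r \<and> v = (\<lambda>k. A 0 k - A 1 k - A 2 k - A 3 k)} =
    \<sigma> ` {v. 3 \<le> r \<and> v = (\<lambda>k. B 0 k - B 1 k - B 2 k - B 3 k)}"
    using assms(2) by (auto simp: weyl_group_diff[OF assms(1)])
  have 2: "{v. \<exists>i. 1 \<le> i \<and> i < r \<and> v = (\<lambda>k. A i k - A (i + 1) k)} =
    \<sigma> ` {v. \<exists>i. 1 \<le> i \<and> i < r \<and> v = (\<lambda>k. B i k - B (i + 1) k)}"
  proof -
    have "(\<lambda>k. A i k - A (i + 1) k) = \<sigma> (\<lambda>k. B i k - B (i + 1) k)" if "i < r" for i
      using assms(2)[of i] assms(2)[of "i + 1"] that by (simp add: weyl_group_diff[OF assms(1)])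
    then show ?thesis by (auto simp: image_iff)
  qed
  show ?thesis unfolding simple_roots_def image_Un 1 2 ..
qed

text \<open>The reflection in \<open>\<sigma> v\<close> is the conjugate by \<sigma> of the
  reflection in \<open>v\<close>, and conjugating a group by one of its own elements returns the
  same group. This is why the Weyl group does not depend on the configuration that defines
  it.\<close>

lemma weyl_group_eq:
  assumes frame: "lorentz_frame r E" and \<sigma>: "\<sigma> \<in> weyl_group r E" and A: "\<And>i. i \<le> r \<Longrightarrow> A i = \<sigma> (E i)"
  shows "weyl_group r A = weyl_group r E"
proof -
  obtain \<tau> where \<tau>: "\<tau> \<in> weyl_group r E" "\<tau> \<circ> \<sigma> = id" "\<sigma> \<circ> \<tau> = id"
    using weyl_group_inverse[OF frame \<sigma>] by blast
  have roots: "simple_roots r A = \<sigma> ` simple_roots r E"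
    using \<sigma> A by (rule simple_roots_image)
  have conj: "reflection r (\<sigma> v) = \<sigma> \<circ> reflection r v \<circ> \<tau>" for v
  proof
    fix x
    have "x = \<sigma> (\<tau> x)" using \<tau>(3) by (simp add: fun_eq_iff)
    then have "reflection r (\<sigma> v) x = reflection r (\<sigma> v) (\<sigma> (\<tau> x))" by simp
    also have "\<dots> = \<sigma> (reflection r v (\<tau> x))"
      by (simp add: reflection_def weyl_group_linear[OF \<sigma>] weyl_group_isometry[OF frame \<sigma>])
    finally show "reflection r (\<sigma> v) x = (\<sigma> \<circ> reflection r v \<circ> \<tau>) x" by simp
  qed
  have "\<rho> \<in> weyl_group r E" if "\<rho> \<in> weyl_group r A" for \<rho>
    using that
  proof induction
    case (weyl_step \<rho> v)
    then obtain u where u: "u \<in> simple_roots r E" "v = \<sigma> u" using roots by auto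
    show ?case unfolding u(2) conj
      by (intro weyl_group_comp \<sigma> \<tau> reflection_in_weyl_group u weyl_step)
  qed (rule weyl_group.weyl_id)
  moreover have conj_in: "\<sigma> \<circ> \<rho> \<circ> \<tau> \<in> weyl_group r A" if "\<rho> \<in> weyl_group r E" for \<rho>
    using that
  proof induction
    case weyl_id
    then show ?case by (simp only: comp_id \<tau>(3) weyl_group.weyl_id)
  next
    case (weyl_step \<rho> v)
    then have "reflection r (\<sigma> v) \<circ> (\<sigma> \<circ> \<rho> \<circ> \<tau>) \<in> weyl_group r A"
      using roots by (intro weyl_group.weyl_step) (simp_all only: imageI)
    also have "reflection r (\<sigma> v) \<circ> (\<sigma> \<circ> \<rho> \<circ> \<tau>) = \<sigma> \<circ> (reflection r v \<circ> \<rho>) \<circ> \<tau>"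
      unfolding conj by (simp add: fun_eq_iff pointfree_idE[OF \<tau>(2)])
    finally show ?case .
  qed
  moreover have "\<rho> \<in> weyl_group r A" if "\<rho> \<in> weyl_group r E" for \<rho>
  proof -
    have "\<sigma> \<circ> (\<tau> \<circ> \<rho> \<circ> \<sigma>) \<circ> \<tau> \<in> weyl_group r A"
      by (intro conj_in weyl_group_comp \<tau> \<sigma> that)
    also have "\<sigma> \<circ> (\<tau> \<circ> \<rho> \<circ> \<sigma>) \<circ> \<tau> = \<rho>" by (simp add: fun_eq_iff pointfree_idE[OF \<tau>(3)])
    finally show ?thesis .
  qed
  ultimately show ?thesis by blast
qed

lemma exceptional_configuration_frame:
  "exceptional_configuration r s t E \<Longrightarrow> lorentz_frame r E"
  by (auto simp: exceptional_configuration_def lorentz_frame_def)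

lemma intersection_class_of:
  assumes "lorentz_frame r E" "i \<le> r"
  shows "intersection r (class_of r E d m) (E i) = (if i = 0 then d else m i)"
proof -
  have "intersection r (class_of r E d m) (E i) =
      d * intersection r (E 0) (E i) - (\<Sum>j=1..r. m j * intersection r (E j) (E i))"
    by (simp add: class_of_def intersection_sum_left)
  also have "(\<Sum>j=1..r. m j * intersection r (E j) (E i)) = (\<Sum>j=1..r. if j = i then - m i else 0)"
    using assms by (intro sum.cong) (auto simp: lorentz_frame_def)
  finally show ?thesis using assms by (auto simp: lorentz_frame_def)
qed

lemma semi_standard_dominant:
  assumes "lorentz_frame r E" "semi_standard_coeffs r d m"
  shows "dominant r E (class_of r E d m)"
  unfolding dominant_def
proof
  note I = intersection_class_of[OF assms(1), of _ d m]
  fix v assume "v \<in> simple_roots r E"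
  then consider "3 \<le> r" "v = (\<lambda>k. E 0 k - E 1 k - E 2 k - E 3 k)"
    | i where "1 \<le> i" "i < r" "v = (\<lambda>k. E i k - E (i + 1) k)"
    unfolding simple_roots_def by blast
  then show "0 \<le> intersection r (class_of r E d m) v"
  proof cases
    case 1
    then show ?thesis using assms(2) I[of 0] I[of 1] I[of 2] I[of 3]
      by (simp add: semi_standard_coeffs_def)
  next
    case (2 i)
    then show ?thesis using assms(2) I[of i] I[of "i + 1"]
      by (simp add: semi_standard_coeffs_def)
  qed
qed

lemma standard_imp_semi_standard: "standard_coeffs r d m \<Longrightarrow> semi_standard_coeffs r d m"
  by (simp add: standard_coeffs_def semi_standard_coeffs_def)

section \<open>Plane curves with assigned multiplicities\<close>

definition linear_functional :: "'j set \<Rightarrow> (('j \<Rightarrow> 'l::field) \<Rightarrow> 'l) \<Rightarrow> bool" where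
  "linear_functional J \<phi> \<longleftrightarrow> (\<exists>a. \<forall>x. \<phi> x = (\<Sum>j\<in>J. a j * x j))"

lemma linear_functional_zero: "linear_functional J (\<lambda>x. 0)"
  unfolding linear_functional_def by (rule exI[of _ "\<lambda>_. 0"]) simp

lemma linear_functional_add:
  assumes "linear_functional J \<phi>" "linear_functional J \<psi>"
  shows "linear_functional J (\<lambda>x. \<phi> x + \<psi> x)"
proof -
  obtain a b where "\<forall>x. \<phi> x = (\<Sum>j\<in>J. a j * x j)" "\<forall>x. \<psi> x = (\<Sum>j\<in>J. b j * x j)"
    using assms unfolding linear_functional_def by blast
  then show ?thesis unfolding linear_functional_def
    by (intro exI[of _ "\<lambda>j. a j + b j"]) (simp add: distrib_right sum.distrib)
qed

lemma linear_functional_scale: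
  assumes "linear_functional J \<phi>"
  shows "linear_functional J (\<lambda>x. c * \<phi> x)" "linear_functional J (\<lambda>x. \<phi> x * c)"
proof -
  obtain a where "\<forall>x. \<phi> x = (\<Sum>j\<in>J. a j * x j)"
    using assms unfolding linear_functional_def by blast
  then show "linear_functional J (\<lambda>x. c * \<phi> x)" unfolding linear_functional_def
    by (intro exI[of _ "\<lambda>j. c * a j"]) (simp add: sum_distrib_left mult.assoc)
  then show "linear_functional J (\<lambda>x. \<phi> x * c)" by (simp add: mult.commute)
qed

lemma linear_functional_diff:
  assumes "linear_functional J \<phi>" "linear_functional J \<psi>"
  shows "linear_functional J (\<lambda>x. \<phi> x - \<psi> x)"
  using linear_functional_add[OF assms(1) linear_functional_scale(1)[OF assms(2), of "-1"]] by simp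

lemma linear_functional_sum:
  assumes "\<And>i. i \<in> I \<Longrightarrow> linear_functional J (\<phi> i)"
  shows "linear_functional J (\<lambda>x. \<Sum>i\<in>I. \<phi> i x)"
  using assms
  by (induction I rule: infinite_finite_induct)
     (auto intro: linear_functional_zero linear_functional_add)

lemma linear_functional_coordinate:
  assumes "finite J" "j \<in> J"
  shows "linear_functional J (\<lambda>x. x j)"
  unfolding linear_functional_def using assms
  by (intro exI[of _ "\<lambda>i. if i = j then 1 else 0"]) (simp add: if_distrib[of "\<lambda>c. c * _"] cong: if_cong)

text \<open>Gaussian elimination by rows: a zero row imposes nothing, and a pivot
  \<open>A i p\<close> removes one row together with one variable, whose value is recovered from
  that row.\<close>

lemma underdetermined_matrix:
  fixes A :: "'i \<Rightarrow> 'j \<Rightarrow> 'l::field"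
  assumes "finite I" "finite J" "card I < card J"
  shows "\<exists>x. (\<exists>j\<in>J. x j \<noteq> 0) \<and> (\<forall>i\<in>I. (\<Sum>j\<in>J. A i j * x j) = 0)"
  using assms
proof (induction I arbitrary: J A rule: finite_induct)
  case empty
  then have "J \<noteq> {}" by auto
  then show ?case by (intro exI[of _ "\<lambda>_. 1"]) auto
next
  case (insert i I)
  show ?case
  proof (cases "\<forall>j\<in>J. A i j = 0")
    case True
    then show ?thesis using insert.IH[of J A] insert.prems insert.hyps by auto
  next
    case False
    then obtain p where p: "p \<in> J" "A i p \<noteq> 0" by blast
    define B where "B = (\<lambda>k j. A k j - A k p * A i j / A i p)"
    have "\<exists>x. (\<exists>j\<in>J - {p}. x j \<noteq> 0) \<and> (\<forall>k\<in>I. (\<Sum>j\<in>J - {p}. B k j * x j) = 0)"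
      using insert p by (intro insert.IH) auto
    then obtain x where x: "\<exists>j\<in>J - {p}. x j \<noteq> 0" "\<forall>k\<in>I. (\<Sum>j\<in>J - {p}. B k j * x j) = 0"
      by blast
    define S where "S = (\<Sum>j\<in>J - {p}. A i j * x j)"
    define y where "y = x(p := - S / A i p)"
    have y: "(\<Sum>j\<in>J. A k j * y j) = (\<Sum>j\<in>J - {p}. A k j * x j) - A k p * S / A i p" for k
    proof -
      have "(\<Sum>j\<in>J. A k j * y j) = A k p * y p + (\<Sum>j\<in>J - {p}. A k j * y j)"
        using insert.prems p by (simp add: sum.remove)
      also have "(\<Sum>j\<in>J - {p}. A k j * y j) = (\<Sum>j\<in>J - {p}. A k j * x j)"
        by (intro sum.cong) (auto simp: y_def)
      finally show ?thesis by (simp add: y_def)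
    qed
    have "(\<Sum>j\<in>J. A k j * y j) = (\<Sum>j\<in>J - {p}. B k j * x j)" for k
      by (simp add: y S_def B_def left_diff_distrib sum_subtractf sum_distrib_left
          sum_divide_distrib mult.assoc)
    then have "\<forall>k\<in>I. (\<Sum>j\<in>J. A k j * y j) = 0" using x(2) by simp
    moreover have "(\<Sum>j\<in>J. A i j * y j) = 0" using p by (simp add: y S_def)
    moreover have "\<exists>j\<in>J. y j \<noteq> 0" using x(1) by (auto simp: y_def)
    ultimately show ?thesis by (intro exI[of _ y]) auto
  qed
qed

text \<open>Conditions are given as a set of functionals, so coinciding ones are harmless and
  \<open>card_image_le\<close> bounds their number.\<close>

lemma underdetermined_system:
  fixes \<Phi> :: "(('j \<Rightarrow> 'l::field) \<Rightarrow> 'l) set"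
  assumes "finite \<Phi>" "finite J" "card \<Phi> < card J" "\<And>\<phi>. \<phi> \<in> \<Phi> \<Longrightarrow> linear_functional J \<phi>"
  obtains x where "\<exists>j\<in>J. x j \<noteq> 0" "\<And>\<phi>. \<phi> \<in> \<Phi> \<Longrightarrow> \<phi> x = 0"
proof -
  have "\<forall>\<phi>\<in>\<Phi>. \<exists>a. \<forall>x. \<phi> x = (\<Sum>j\<in>J. a j * x j)"
    using assms(4) by (simp add: linear_functional_def)
  then obtain A where A: "\<And>\<phi> x. \<phi> \<in> \<Phi> \<Longrightarrow> \<phi> x = (\<Sum>j\<in>J. A \<phi> j * x j)" by metis
  obtain x where "\<exists>j\<in>J. x j \<noteq> 0" "\<forall>\<phi>\<in>\<Phi>. (\<Sum>j\<in>J. A \<phi> j * x j) = 0"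
    using underdetermined_matrix[OF assms(1-3), of A] by blast
  then show thesis using that A by metis
qed

text \<open>It serves two purposes: \<open>triangle m\<close> indexes the Taylor coefficients that
  vanish at an \<open>m\<close>-fold point, \<open>triangle (Suc d)\<close> the monomials of degree
  \<open>d\<close>, with the exponent of \<open>X\<^sub>0\<close> left out.\<close>

definition triangle :: "nat \<Rightarrow> (nat \<times> nat) set" where
  "triangle n = {(a, b). a + b < n}"

lemma triangle_iff [simp]: "(a, b) \<in> triangle n \<longleftrightarrow> a + b < n"
  by (simp add: triangle_def)

lemma triangle_Suc: "triangle (Suc n) = triangle n \<union> (\<lambda>a. (a, n - a)) ` {..n}"
  by (auto simp: triangle_def image_iff)

lemma finite_triangle [simp]: "finite (triangle n)"
  by (induction n) (simp_all only: triangle_Suc finite_Un finite_imageI finite_atMost,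
     simp add: triangle_def)

lemma card_triangle: "2 * card (triangle n) = n * (n + 1)"
proof (induction n)
  case (Suc n)
  have "card (triangle (Suc n)) = card (triangle n) + card ((\<lambda>a. (a, n - a)) ` {..n})"
    unfolding triangle_Suc by (intro card_Un_disjoint) auto
  also have "card ((\<lambda>a. (a, n - a)) ` {..n}) = n + 1"
    by (subst card_image) (auto simp: inj_on_def)
  finally show ?case using Suc by simp
qed (simp add: triangle_def)

text \<open>The cross term is the arithmetic source of Bezout's bound, both for the local
  contributions and for the product of the degrees.\<close>

lemma card_triangle_add: "card (triangle (m + n)) = card (triangle m) + card (triangle n) + m * n"
  using card_triangle[of "m + n"] card_triangle[of m] card_triangle[of n]
  by (simp add: algebra_simps)

section \<open>Ternary forms and their factors\<close>

abbreviation coeff2 :: "'l::zero poly poly \<Rightarrow> nat \<Rightarrow> nat \<Rightarrow> 'l" where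
  "coeff2 p j k \<equiv> coeff (coeff p j) k"

abbreviation coeff3 :: "'l::zero poly poly poly \<Rightarrow> nat \<Rightarrow> nat \<Rightarrow> nat \<Rightarrow> 'l" where
  "coeff3 f i j k \<equiv> coeff (coeff (coeff f i) j) k"

lemma coeff2_mult:
  "coeff2 (p * q) j k = (\<Sum>a\<le>j. \<Sum>b\<le>k. coeff2 p a b * coeff2 q (j - a) (k - b))"
  for p q :: "'l::comm_semiring_0 poly poly"
  by (simp add: coeff_mult coeff_sum)

lemma coeff3_mult:
  "coeff3 (f * g) i j k =
    (\<Sum>a\<le>i. \<Sum>b\<le>j. \<Sum>c\<le>k. coeff3 f a b c * coeff3 g (i - a) (j - b) (k - c))"
  for f g :: "'l::comm_semiring_0 poly poly poly"
  by (simp add: coeff_mult coeff_sum)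

lemma coeff3_eqI: "(\<And>i j k. coeff3 f i j k = coeff3 g i j k) \<Longrightarrow> f = g"
  by (intro poly_eqI) blast

definition form_with_coeffs :: "nat \<Rightarrow> (nat \<times> nat \<Rightarrow> 'l::field) \<Rightarrow> 'l poly poly poly" where
  "form_with_coeffs n x =
     (\<Sum>(a, b)\<in>triangle (Suc n). monom (monom (monom (x (a, b)) b) a) (n - a - b))"

lemma coeff3_form_with_coeffs:
  "coeff3 (form_with_coeffs n x) i j k = (if i + j + k = n then x (j, k) else 0)"
proof -
  have monom: "coeff3 (monom (monom (monom c k') j') i') i j k =
      (if i = i' \<and> j = j' \<and> k = k' then c else 0)" for c :: 'a and i j k i' j' k'
    by simp
  have "coeff3 (form_with_coeffs n x) i j k =
      (\<Sum>p\<in>triangle (Suc n). coeff3 (case p of (a, b) \<Rightarrow>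
         monom (monom (monom (x (a, b)) b) a) (n - a - b)) i j k)"
    by (simp add: form_with_coeffs_def coeff_sum)
  also have "\<dots> = (\<Sum>p\<in>triangle (Suc n). if p = (j, k) then (if i + j + k = n then x (j, k) else 0) else 0)"
    by (intro sum.cong) (auto simp: monom simp del: coeff_monom split: if_splits)
  also have "\<dots> = (if i + j + k = n then x (j, k) else 0)" by auto
  finally show ?thesis .
qed

lemma ternary_form_with_coeffs: "ternary_form n (form_with_coeffs n x)"
  by (auto simp: ternary_form_def coeff3_form_with_coeffs split: if_splits)

lemma ternary_formD: "ternary_form n f \<Longrightarrow> i + j + k \<noteq> n \<Longrightarrow> coeff3 f i j k = 0"
  by (auto simp: ternary_form_def)

lemma ternary_form_add: "ternary_form n f \<Longrightarrow> ternary_form n g \<Longrightarrow> ternary_form n (f + g)"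
  unfolding ternary_form_def by (metis add.right_neutral coeff_add)

lemma ternary_form_sum:
  "(\<And>i. i \<in> I \<Longrightarrow> ternary_form n (f i)) \<Longrightarrow> ternary_form n (\<Sum>i\<in>I. f i)"
  by (induction I rule: infinite_finite_induct) (auto simp: ternary_form_add, auto simp: ternary_form_def)

lemma ternary_form_mult:
  assumes "ternary_form m f" "ternary_form n g"
  shows "ternary_form (m + n) (f * g)"
  unfolding ternary_form_def
proof (intro allI impI)
  fix i j k assume "coeff3 (f * g) i j k \<noteq> 0"
  then obtain a where a: "a \<le> i"
    "(\<Sum>b\<le>j. \<Sum>c\<le>k. coeff3 f a b c * coeff3 g (i - a) (j - b) (k - c)) \<noteq> 0"
    unfolding coeff3_mult by (meson atMost_iff sum.not_neutral_contains_not_neutral)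
  then obtain b where b: "b \<le> j" "(\<Sum>c\<le>k. coeff3 f a b c * coeff3 g (i - a) (j - b) (k - c)) \<noteq> 0"
    by (meson atMost_iff sum.not_neutral_contains_not_neutral)
  then obtain c where c: "c \<le> k" "coeff3 f a b c * coeff3 g (i - a) (j - b) (k - c) \<noteq> 0"
    by (meson atMost_iff sum.not_neutral_contains_not_neutral)
  then have "coeff3 f a b c \<noteq> 0" "coeff3 g (i - a) (j - b) (k - c) \<noteq> 0" by auto
  then have "a + b + c = m" "(i - a) + (j - b) + (k - c) = n"
    using assms unfolding ternary_form_def by blast+
  then show "i + j + k = m + n" using a b c by linarith
qed

lemma ternary_form_1: "ternary_form 0 1"
  by (auto simp: ternary_form_def of_bool_def split: if_splits)

lemma ternary_form_power: "ternary_form n f \<Longrightarrow> ternary_form (k * n) (f ^ k)"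
  by (induction k) (auto simp: ternary_form_1 intro: ternary_form_mult)

lemma ternary_form_prod:
  "(\<And>i. i \<in> I \<Longrightarrow> ternary_form (n i) (f i)) \<Longrightarrow> ternary_form (\<Sum>i\<in>I. n i) (\<Prod>i\<in>I. f i)"
  by (induction I rule: infinite_finite_induct) (auto simp: ternary_form_1 ternary_form_mult)

lemma ternary_form_eqI:
  assumes "ternary_form n f" "ternary_form n g"
    and "\<And>j k. j + k \<le> n \<Longrightarrow> coeff3 f (n - j - k) j k = coeff3 g (n - j - k) j k"
  shows "f = g"
proof (rule coeff3_eqI)
  fix i j k
  show "coeff3 f i j k = coeff3 g i j k"
  proof (cases "i + j + k = n")
    case True
    then have "i = n - j - k" "j + k \<le> n" by auto
    then show ?thesis using assms(3) by simp
  next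
    case False
    then show ?thesis using assms(1,2) by (simp add: ternary_formD)
  qed
qed

definition homogeneous_part :: "nat \<Rightarrow> 'l::field poly poly poly \<Rightarrow> 'l poly poly poly" where
  "homogeneous_part n f = form_with_coeffs n (\<lambda>(j, k). coeff3 f (n - j - k) j k)"

lemma coeff3_homogeneous_part:
  "coeff3 (homogeneous_part n f) i j k = (if i + j + k = n then coeff3 f i j k else 0)"
  by (auto simp: homogeneous_part_def coeff3_form_with_coeffs)

lemma homogeneous_part_mult:
  assumes "ternary_form d f"
  shows "homogeneous_part (d + n) (f * c) = f * homogeneous_part n c"
proof (rule coeff3_eqI)
  fix i j k
  show "coeff3 (homogeneous_part (d + n) (f * c)) i j k = coeff3 (f * homogeneous_part n c) i j k"
  proof (cases "i + j + k = d + n")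
    case True
    have eq: "coeff3 f a b l * coeff3 (homogeneous_part n c) (i - a) (j - b) (k - l) =
        coeff3 f a b l * coeff3 c (i - a) (j - b) (k - l)"
      if "a \<le> i" "b \<le> j" "l \<le> k" for a b l
    proof (cases "a + b + l = d")
      case True
      then have "i - a + (j - b) + (k - l) = n" using that \<open>i + j + k = d + n\<close> by linarith
      then show ?thesis by (simp add: coeff3_homogeneous_part)
    qed (simp add: ternary_formD[OF assms])
    have "coeff3 (homogeneous_part (d + n) (f * c)) i j k = coeff3 (f * c) i j k"
      using True by (simp add: coeff3_homogeneous_part)
    also have "\<dots> = coeff3 (f * homogeneous_part n c) i j k"
      unfolding coeff3_mult by (intro sum.cong refl eq[symmetric]) auto
    finally show ?thesis .
  next
    case False
    have "ternary_form (d + n) (f * homogeneous_part n c)"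
      unfolding homogeneous_part_def
      by (intro ternary_form_mult assms ternary_form_with_coeffs)
    with False show ?thesis by (simp add: coeff3_homogeneous_part ternary_formD)
  qed
qed

text \<open>A homogeneous part of \<open>c\<close> in a wrong degree becomes, multiplied by
  \<open>f\<close>, a part of \<open>f * c\<close> outside degree \<open>n\<close>. That is zero,
  and \<open>f\<close> cancels.\<close>

lemma ternary_form_cofactor:
  assumes "ternary_form d f" "ternary_form n (f * c)" "f * c \<noteq> 0"
  shows "d \<le> n" "ternary_form (n - d) c"
proof -
  have deg: "d + (i + j + k) = n" if "coeff3 c i j k \<noteq> 0" for i j k
  proof (rule ccontr)
    assume neq: "d + (i + j + k) \<noteq> n"
    have "f * homogeneous_part (i + j + k) c = homogeneous_part (d + (i + j + k)) (f * c)"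
      by (simp add: homogeneous_part_mult[OF assms(1)])
    also have "\<dots> = 0"
      using assms(2) neq by (intro coeff3_eqI) (auto simp: coeff3_homogeneous_part ternary_formD)
    finally have "homogeneous_part (i + j + k) c = 0" using assms(3) by auto
    then have "coeff3 (homogeneous_part (i + j + k) c) i j k = 0" by simp
    with that show False by (simp add: coeff3_homogeneous_part)
  qed
  have "\<exists>i j k. coeff3 c i j k \<noteq> 0"
    using assms(3) coeff3_eqI[of c 0] by fastforce
  with deg show "d \<le> n" by (metis le_add1)
  show "ternary_form (n - d) c" unfolding ternary_form_def using deg by fastforce
qed

section \<open>Local equations and orders of vanishing\<close>

lemma local_equation_add: "local_equation (f + g) a b = local_equation f a b + local_equation g a b"
proof -
  have "map_poly (\<lambda>c. pcompose c [:b, 1:]) (p + q) =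
      map_poly (\<lambda>c. pcompose c [:b, 1:]) p + map_poly (\<lambda>c. pcompose c [:b, 1:]) q" for p q
    by (intro poly_eqI) (simp add: coeff_map_poly pcompose_add)
  then show ?thesis by (simp add: local_equation_def pcompose_add)
qed

lemma local_equation_mult: "local_equation (f * g) a b = local_equation f a b * local_equation g a b"
proof -
  have "map_poly (\<lambda>c. pcompose c [:b, 1:]) (p * q) =
      map_poly (\<lambda>c. pcompose c [:b, 1:]) p * map_poly (\<lambda>c. pcompose c [:b, 1:]) q" for p q
    by (intro poly_eqI) (simp add: coeff_map_poly coeff_mult pcompose_sum pcompose_mult)
  then show ?thesis by (simp add: local_equation_def pcompose_mult)
qed

lemma local_equation_0 [simp]: "local_equation 0 a b = 0"
  by (simp add: local_equation_def)

lemma local_equation_1 [simp]: "local_equation 1 a b = 1"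
  by (simp add: local_equation_def map_poly_1 pcompose_1)

lemma local_equation_sum: "local_equation (\<Sum>i\<in>I. f i) a b = (\<Sum>i\<in>I. local_equation (f i) a b)"
  by (induction I rule: infinite_finite_induct) (simp_all add: local_equation_add)

lemma local_equation_prod: "local_equation (\<Prod>i\<in>I. f i) a b = (\<Prod>i\<in>I. local_equation (f i) a b)"
  by (induction I rule: infinite_finite_induct) (simp_all add: local_equation_mult)

lemma local_equation_power: "local_equation (f ^ n) a b = local_equation f a b ^ n"
  by (induction n) (simp_all add: local_equation_mult)

lemma local_equation_smult: "local_equation (smult [:[:c:]:] f) a b = smult [:c:] (local_equation f a b)"
proof -
  have "map_poly (\<lambda>c. pcompose c [:b, 1:]) [:[:c:]:] = [:[:c:]:]"
    by (intro poly_eqI) (simp add: coeff_map_poly coeff_pCons split: nat.splits)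
  then have const: "local_equation [:[:[:c:]:]:] a b = [:[:c:]:]"
    by (simp add: local_equation_def)
  have "local_equation (smult [:[:c:]:] f) a b = local_equation ([:[:[:c:]:]:] * f) a b" by simp
  also have "\<dots> = [:[:c:]:] * local_equation f a b"
    unfolding local_equation_mult const ..
  finally show ?thesis by simp
qed

text \<open>Setting \<open>X\<^sub>0 = 1\<close> loses nothing on a form, since the exponents of
  \<open>x\<close> and \<open>y\<close> determine that of \<open>X\<^sub>0\<close>; translations are
  injective.\<close>

lemma local_equation_eq_0_iff:
  assumes "ternary_form d f"
  shows "local_equation f a b = 0 \<longleftrightarrow> f = 0"
proof
  assume "local_equation f a b = 0"
  then have "map_poly (\<lambda>c. pcompose c [:b, 1:]) (poly f 1) = 0"
    unfolding local_equation_def by (rule pcompose_eq_0) simp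
  then have "pcompose (coeff (poly f 1) j) [:b, 1:] = 0" for j
    by (metis (no_types, lifting) coeff_0 coeff_map_poly pcompose_0)
  then have "coeff (poly f 1) j = 0" for j
    by (rule pcompose_eq_0) simp
  then have poly_0: "poly f 1 = 0" by (intro poly_eqI) simp
  show "f = 0"
  proof (rule coeff3_eqI)
    fix i j k
    have "coeff2 (poly f 1) j k = (\<Sum>l\<le>degree f. coeff3 f l j k)"
      by (simp add: poly_altdef coeff_sum)
    also have "\<dots> = (\<Sum>l\<le>degree f. if l = i then coeff3 f i j k else 0)" if "i + j + k = d"
      using that by (intro sum.cong) (auto intro!: ternary_formD[OF assms])
    also have "\<dots> = coeff3 f i j k" by (auto simp: coeff_eq_0)
    finally show "coeff3 f i j k = coeff3 0 i j k"
      using poly_0 ternary_formD[OF assms, of i j k] by (cases "i + j + k = d") auto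
  qed
qed simp

definition vanishes_to :: "nat \<Rightarrow> 'l::zero poly poly \<Rightarrow> bool" where
  "vanishes_to m p \<longleftrightarrow> (\<forall>j k. j + k < m \<longrightarrow> coeff2 p j k = 0)"

lemma vanishes_to_0 [simp]: "vanishes_to 0 p"
  by (simp add: vanishes_to_def)

lemma vanishes_to_add: "vanishes_to m p \<Longrightarrow> vanishes_to m q \<Longrightarrow> vanishes_to m (p + q)"
  for p q :: "'l::comm_monoid_add poly poly"
  by (simp add: vanishes_to_def)

lemma vanishes_to_mult:
  fixes p q :: "'l::idom poly poly"
  assumes "vanishes_to m p" "vanishes_to n q"
  shows "vanishes_to (m + n) (p * q)"
  unfolding vanishes_to_def
proof (intro allI impI)
  fix j k assume jk: "j + k < m + n"
  have "coeff2 p a b * coeff2 q (j - a) (k - b) = 0" if "a \<le> j" "b \<le> k" for a b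
  proof (cases "a + b < m")
    case True
    then show ?thesis using assms(1) by (simp add: vanishes_to_def)
  next
    case False
    then have "j - a + (k - b) < n" using jk that by linarith
    then show ?thesis using assms(2) by (simp add: vanishes_to_def)
  qed
  then show "coeff2 (p * q) j k = 0" unfolding coeff2_mult by (intro sum.neutral ballI) simp
qed

lemma vanishes_to_power:
  fixes p :: "'l::idom poly poly"
  shows "vanishes_to m p \<Longrightarrow> vanishes_to (n * m) (p ^ n)"
  by (induction n) (auto intro: vanishes_to_mult)

text \<open>Orders of vanishing add, because the lowest-degree parts of the factors have a nonzero
  product. The subtraction is truncated; for \<open>m \<le> \<mu>\<close> the claim is
  empty.\<close>

lemma vanishes_to_cofactor:
  fixes p q :: "'l::idom poly poly"
  assumes p: "vanishes_to \<mu> p" and nz: "j0 + k0 = \<mu>" "coeff2 p j0 k0 \<noteq> 0"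
    and pq: "vanishes_to m (p * q)"
  shows "vanishes_to (m - \<mu>) q"
proof (rule ccontr)
  assume "\<not> ?thesis"
  then have ex: "\<exists>n. \<exists>j k. j + k = n \<and> coeff2 q j k \<noteq> 0" by (auto simp: vanishes_to_def)
  define \<nu> where "\<nu> = (LEAST n. \<exists>j k. j + k = n \<and> coeff2 q j k \<noteq> 0)"
  have \<nu>: "\<exists>j k. j + k = \<nu> \<and> coeff2 q j k \<noteq> 0" unfolding \<nu>_def by (rule LeastI_ex[OF ex])
  have q: "vanishes_to \<nu> q"
    unfolding vanishes_to_def \<nu>_def using not_less_Least by blast
  have "\<nu> < m - \<mu>"
  proof (rule ccontr)
    assume "\<not> \<nu> < m - \<mu>"
    with q have "vanishes_to (m - \<mu>) q" by (auto simp: vanishes_to_def)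
    with \<open>\<not> vanishes_to (m - \<mu>) q\<close> show False by simp
  qed
  \<comment> \<open>\<open>a\<close> and \<open>c\<close> are the least \<open>x\<close>-exponents
    in the lowest-degree parts; the product of these two monomials arises in one way and cannot
    cancel.\<close>
  define a where "a = (LEAST j. \<exists>k. j + k = \<mu> \<and> coeff2 p j k \<noteq> 0)"
  define c where "c = (LEAST j. \<exists>k. j + k = \<nu> \<and> coeff2 q j k \<noteq> 0)"
  have "\<exists>k. a + k = \<mu> \<and> coeff2 p a k \<noteq> 0"
    unfolding a_def using nz by (intro LeastI_ex[of "\<lambda>j. \<exists>k. j + k = \<mu> \<and> coeff2 p j k \<noteq> 0"]) blast
  then obtain b where b: "a + b = \<mu>" "coeff2 p a b \<noteq> 0" by blast
  have "\<exists>k. c + k = \<nu> \<and> coeff2 q c k \<noteq> 0"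
    unfolding c_def using \<nu> by (intro LeastI_ex[of "\<lambda>j. \<exists>k. j + k = \<nu> \<and> coeff2 q j k \<noteq> 0"]) blast
  then obtain d where d: "c + d = \<nu>" "coeff2 q c d \<noteq> 0" by blast
  have a_min: "coeff2 p j k = 0" if "j + k = \<mu>" "j < a" for j k
    using not_less_Least[of j "\<lambda>j. \<exists>k. j + k = \<mu> \<and> coeff2 p j k \<noteq> 0"] that unfolding a_def by blast
  have c_min: "coeff2 q j k = 0" if "j + k = \<nu>" "j < c" for j k
    using not_less_Least[of j "\<lambda>j. \<exists>k. j + k = \<nu> \<and> coeff2 q j k \<noteq> 0"] that unfolding c_def by blast
  have summand: "coeff2 p j k * coeff2 q (a + c - j) (b + d - k) =
      (if j = a then if k = b then coeff2 p a b * coeff2 q c d else 0 else 0)"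
    if "j \<le> a + c" "k \<le> b + d" for j k
  proof (cases "j + k = \<mu>")
    case True
    then have sum: "(a + c - j) + (b + d - k) = \<nu>" using that b(1) d(1) by linarith
    consider "j < a" | "a < j" | "j = a" by linarith
    then show ?thesis
    proof cases
      case 1
      then show ?thesis using a_min[OF True] by simp
    next
      case 2
      then have "a + c - j < c" using that by linarith
      then show ?thesis using c_min[OF sum] 2 by simp
    next
      case 3
      then show ?thesis using True b(1) by auto
    qed
  next
    case False
    have "coeff2 p j k = 0 \<or> coeff2 q (a + c - j) (b + d - k) = 0"
    proof (cases "j + k < \<mu>")
      case True
      then show ?thesis using p by (simp add: vanishes_to_def)
    next
      case not_less: False
      then have "(a + c - j) + (b + d - k) < \<nu>" using False that b(1) d(1) by linarith
      then show ?thesis using q by (simp add: vanishes_to_def)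
    qed
    then show ?thesis using False b(1) by auto
  qed
  have "coeff2 (p * q) (a + c) (b + d) =
      (\<Sum>j\<le>a + c. \<Sum>k\<le>b + d. if j = a then if k = b then coeff2 p a b * coeff2 q c d else 0 else 0)"
    unfolding coeff2_mult by (intro sum.cong refl summand) auto
  also have "\<dots> = (\<Sum>j\<le>a + c. if j = a then coeff2 p a b * coeff2 q c d else 0)"
    by (intro sum.cong) auto
  also have "\<dots> = coeff2 p a b * coeff2 q c d" by simp
  finally have "coeff2 (p * q) (a + c) (b + d) \<noteq> 0" using b d by simp
  moreover have "a + c + (b + d) < m" using b(1) d(1) \<open>\<nu> < m - \<mu>\<close> by linarith
  ultimately show False using pq by (auto simp: vanishes_to_def)
qed

lemma multiplicity_at_attained:
  assumes "ternary_form d f" "f \<noteq> 0"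
  shows "\<exists>j k. j + k = multiplicity_at f a b \<and> coeff2 (local_equation f a b) j k \<noteq> 0"
proof -
  have "local_equation f a b \<noteq> 0" using local_equation_eq_0_iff[OF assms(1)] assms(2) by simp
  then have "\<exists>m. \<exists>j k. j + k = m \<and> coeff2 (local_equation f a b) j k \<noteq> 0"
    by (metis coeff_0 poly_eqI)
  then show ?thesis unfolding multiplicity_at_def by (rule LeastI_ex)
qed

lemma vanishes_to_multiplicity_at: "vanishes_to (multiplicity_at f a b) (local_equation f a b)"
  unfolding vanishes_to_def multiplicity_at_def using not_less_Least by blast

text \<open>This is \<open>X\<^sub>1 - c X\<^sub>0\<close>; the next two are
  \<open>X\<^sub>2 - c X\<^sub>0\<close> and \<open>X\<^sub>0\<close>. The first two provide local
  coordinates at a point; the third misses the affine chart and serves to pad the degree.\<close>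

definition vertical_line :: "'l::field \<Rightarrow> 'l poly poly poly" where
  "vertical_line c = [:[:0, 1:], [:[:- c:]:]:]"

definition horizontal_line :: "'l::field \<Rightarrow> 'l poly poly poly" where
  "horizontal_line c = [:[:[:0, 1:]:], [:[:- c:]:]:]"

definition line_at_infinity :: "'l::field poly poly poly" where
  "line_at_infinity = [:0, 1:]"

lemma ternary_form_lines:
  "ternary_form 1 (vertical_line c)" "ternary_form 1 (horizontal_line c)" "ternary_form 1 line_at_infinity"
  unfolding ternary_form_def vertical_line_def horizontal_line_def line_at_infinity_def
  by (auto simp: coeff_pCons split: nat.splits if_splits)

lemma local_equation_vertical_line: "local_equation (vertical_line c) a b = [:[:a - c:], 1:]"
proof -
  have "map_poly (\<lambda>c. pcompose c [:b, 1:]) [:[:- c:], 1:] = [:[:- c:], 1:]"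
    by (intro poly_eqI) (auto simp: coeff_map_poly coeff_pCons pcompose_1 split: nat.splits)
  moreover have "poly (vertical_line c) 1 = [:[:- c:], 1:]" by (simp add: vertical_line_def)
  ultimately show ?thesis by (simp add: local_equation_def pcompose_pCons)
qed

lemma local_equation_horizontal_line: "local_equation (horizontal_line c) a b = [:[:b - c, 1:]:]"
proof -
  have "map_poly (\<lambda>c. pcompose c [:b, 1:]) [:[:- c, 1:]:] = [:[:b - c, 1:]:]"
    by (intro poly_eqI) (auto simp: coeff_map_poly coeff_pCons pcompose_pCons split: nat.splits)
  moreover have "poly (horizontal_line c) 1 = [:[:- c, 1:]:]" by (simp add: horizontal_line_def)
  ultimately show ?thesis by (simp add: local_equation_def)
qed

lemma local_equation_line_at_infinity: "local_equation line_at_infinity a b = 1"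
proof -
  have "poly line_at_infinity 1 = (1 :: 'a poly poly)" by (simp add: line_at_infinity_def)
  then show ?thesis by (simp add: local_equation_def map_poly_1 pcompose_1)
qed

text \<open>Forms of degree \<open>n\<close> whose local equation at the \<open>i\<close>-th point starts with \<open>x\<^sup>a y\<^sup>b\<close> and which
  vanish to high order at the other points; the points have distinct \<open>x\<close>-coordinates.\<close>

definition interpolation_form ::
    "'i set \<Rightarrow> ('i \<Rightarrow> 'l::field) \<Rightarrow> ('i \<Rightarrow> 'l) \<Rightarrow> ('i \<Rightarrow> nat) \<Rightarrow> nat \<Rightarrow> 'i \<Rightarrow> nat \<Rightarrow> nat \<Rightarrow> 'l poly poly poly"
  where
  "interpolation_form I s t N n i a b =
     line_at_infinity ^ (n - ((\<Sum>j\<in>I - {i}. N j) + a + b)) * (\<Prod>j\<in>I - {i}. vertical_line (s j) ^ N j) *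
     vertical_line (s i) ^ a * horizontal_line (t i) ^ b"

lemma ternary_form_interpolation_form:
  assumes "finite I" "i \<in> I" "a + b < N i" "(\<Sum>j\<in>I. N j) \<le> n"
  shows "ternary_form n (interpolation_form I s t N n i a b)"
proof -
  let ?S = "\<Sum>j\<in>I - {i}. N j"
  have "?S + N i \<le> n" using assms by (simp add: sum.remove)
  \<comment> \<open>Because \<open>a + b < N i\<close>, the exponent of the line at infinity is not
    truncated.\<close>
  then have n: "n - (?S + a + b) + ?S + a + b = n" using assms(3) by linarith
  have lines: "ternary_form k (vertical_line c ^ k)" "ternary_form k (horizontal_line c ^ k)"
    "ternary_form k (line_at_infinity ^ k)" for k and c :: 'b
    using ternary_form_power[OF ternary_form_lines(1)] ternary_form_power[OF ternary_form_lines(2)]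
      ternary_form_power[OF ternary_form_lines(3)] by (metis mult.right_neutral)+
  have "ternary_form (n - (?S + a + b) + ?S + a + b) (interpolation_form I s t N n i a b)"
    unfolding interpolation_form_def by (intro ternary_form_mult ternary_form_prod lines)
  then show ?thesis unfolding n .
qed

lemma interpolation_form_vanishes:
  assumes "finite I" "l \<in> I" "l \<noteq> i"
  shows "vanishes_to (N l) (local_equation (interpolation_form I s t N n i a b) (s l) (t l))"
proof -
  let ?L = "\<lambda>f. local_equation f (s l) (t l)"
  have "vanishes_to 1 (?L (vertical_line (s l)))"
    by (auto simp: vanishes_to_def local_equation_vertical_line)
  then have "vanishes_to (N l * 1) (?L (vertical_line (s l) ^ N l))"
    unfolding local_equation_power by (rule vanishes_to_power)
  then have "vanishes_to (N l) (?L (vertical_line (s l) ^ N l))" by simp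
  moreover have "(\<Prod>j\<in>I - {i}. vertical_line (s j) ^ N j) =
      vertical_line (s l) ^ N l * (\<Prod>j\<in>I - {i} - {l}. vertical_line (s j) ^ N j)"
    using assms by (intro prod.remove) auto
  ultimately have "vanishes_to (0 + (N l + 0) + 0 + 0) (?L (interpolation_form I s t N n i a b))"
    unfolding interpolation_form_def local_equation_mult
    by (intro vanishes_to_mult) (simp_all only: local_equation_mult vanishes_to_mult vanishes_to_0)
  then show ?thesis by simp
qed

text \<open>The local equation is \<open>x^a y^b\<close> times \<open>Q\<close>, whose constant term
  is nonzero: the vertical lines through the other points miss this one.\<close>

lemma interpolation_form_leading:
  assumes "finite I" "inj_on s I" "i \<in> I"
  shows "coeff2 (local_equation (interpolation_form I s t N n i a b) (s i) (t i)) a b \<noteq> 0"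
    and "\<And>a' b'. a' + b' \<le> a + b \<Longrightarrow> (a', b') \<noteq> (a, b) \<Longrightarrow>
      coeff2 (local_equation (interpolation_form I s t N n i a b) (s i) (t i)) a' b' = 0"
proof -
  let ?L = "\<lambda>f. local_equation f (s i) (t i)"
  define Q where "Q = (\<Prod>j\<in>I - {i}. [:[:s i - s j:], 1:] ^ N j)"
  have "?L (interpolation_form I s t N n i a b) = Q * [:0, 1:] ^ a * [:[:0, 1:]:] ^ b"
    by (simp add: interpolation_form_def local_equation_mult local_equation_power local_equation_prod
        local_equation_vertical_line local_equation_horizontal_line local_equation_line_at_infinity Q_def)
  also have "[:[:0, 1:]:] ^ b = [:[:0, 1:] ^ b :: 'b poly:]"
    by (simp add: poly_const_pow)
  also have "[:0, 1:] ^ b = monom (1 :: 'b) b" by (simp add: monom_altdef)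
  also have "[:0, 1:] ^ a = monom (1 :: 'b poly) a" by (simp add: monom_altdef)
  also have "Q * monom 1 a * [:monom 1 b:] = [:monom 1 b:] * monom 1 a * Q"
    by (simp only: mult_ac)
  also have "[:monom 1 b:] * monom 1 a = monom (monom (1 :: 'b) b) a" by (simp add: smult_monom)
  finally have L: "?L (interpolation_form I s t N n i a b) = monom (monom 1 b) a * Q" .
  have coeff: "coeff2 (monom (monom 1 b) a * Q) a' b' =
      (if a \<le> a' \<and> b \<le> b' then coeff2 Q (a' - a) (b' - b) else 0)" for a' b'
    by (auto simp: coeff_monom_mult)
  have "poly Q 0 = (\<Prod>j\<in>I - {i}. [:s i - s j:] ^ N j)" by (simp add: Q_def poly_prod)
  then have "poly (poly Q 0) 0 = (\<Prod>j\<in>I - {i}. (s i - s j) ^ N j)" by (simp add: poly_prod)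
  also have "\<dots> \<noteq> 0" using assms by (auto simp: inj_on_def)
  finally have "coeff2 Q 0 0 \<noteq> 0" by (simp add: poly_0_coeff_0)
  then show "coeff2 (?L (interpolation_form I s t N n i a b)) a b \<noteq> 0"
    unfolding L coeff by simp
  show "coeff2 (?L (interpolation_form I s t N n i a b)) a' b' = 0"
    if "a' + b' \<le> a + b" "(a', b') \<noteq> (a, b)" for a' b'
    unfolding L coeff using that by auto
qed

lemma coeff2_local_equation_form:
  "coeff2 (local_equation (form_with_coeffs n x) a b) j k =
    (\<Sum>p\<in>triangle (Suc n). x p *
       coeff2 (local_equation (monom (monom (monom 1 (snd p)) (fst p)) (n - fst p - snd p)) a b) j k)"
proof -
  have "form_with_coeffs n x = (\<Sum>p\<in>triangle (Suc n). smult [:[:x p:]:]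
      (monom (monom (monom 1 (snd p)) (fst p)) (n - fst p - snd p)))"
    unfolding form_with_coeffs_def
    by (intro sum.cong) (auto simp: smult_monom)
  then show ?thesis by (simp add: local_equation_sum local_equation_smult coeff_sum)
qed

text \<open>The map \<open>c\<close> selects the block of \<open>J\<close> that holds the
  coefficients of one form; several forms can thus share one system of unknowns.\<close>

lemma linear_functional_coeff3_form:
  assumes "finite J" "c ` triangle (Suc n) \<subseteq> J"
  shows "linear_functional J (\<lambda>x. coeff3 (form_with_coeffs n (\<lambda>p. x (c p))) i j k)"
proof (cases "i + j + k = n")
  case True
  then have "(j, k) \<in> triangle (Suc n)" by simp
  then have "c (j, k) \<in> J" using assms(2) by blast
  then show ?thesis
    using True assms(1) by (simp add: coeff3_form_with_coeffs linear_functional_coordinate)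
qed (simp add: coeff3_form_with_coeffs linear_functional_zero)

lemma linear_functional_local_equation_form:
  assumes "finite J" "c ` triangle (Suc n) \<subseteq> J"
  shows "linear_functional J (\<lambda>x. coeff2 (local_equation (form_with_coeffs n (\<lambda>p. x (c p))) a b) j k)"
  unfolding coeff2_local_equation_form using assms
  by (intro linear_functional_sum linear_functional_scale linear_functional_coordinate) auto

lemma linear_functional_coeff3_mult:
  assumes "\<And>i j k. linear_functional J (\<lambda>x. coeff3 (h x) i j k)"
  shows "linear_functional J (\<lambda>x. coeff3 (f * h x) i j k)"
  unfolding coeff3_mult by (intro linear_functional_sum linear_functional_scale assms)

lemma card_Sigma_triangle:
  "finite I \<Longrightarrow> card (SIGMA i:I. triangle (m i)) = (\<Sum>i\<in>I. card (triangle (m i)))"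
  by (simp add: card_SigmaI)

text \<open>The existence half of Riemann-Roch: an \<open>m\<close>-fold point costs
  \<open>card (triangle m)\<close> linear conditions.\<close>

lemma exists_form_vanishing:
  fixes s t :: "'i \<Rightarrow> 'l::field"
  assumes "finite I" "(\<Sum>i\<in>I. card (triangle (m i))) < card (triangle (Suc d))"
  shows "\<exists>g. ternary_form d g \<and> g \<noteq> 0 \<and> (\<forall>i\<in>I. vanishes_to (m i) (local_equation g (s i) (t i)))"
proof -
  let ?J = "triangle (Suc d)" and ?T = "SIGMA i:I. triangle (m i)"
  define \<phi> where "\<phi> = (\<lambda>(i, j, k) (x :: nat \<times> nat \<Rightarrow> 'l).
     coeff2 (local_equation (form_with_coeffs d (\<lambda>p. x p)) (s i) (t i)) j k)"
  have "card (\<phi> ` ?T) \<le> card ?T" using assms(1) by (intro card_image_le) simp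
  then have card: "card (\<phi> ` ?T) < card ?J" using assms by (simp add: card_Sigma_triangle)
  have lin: "linear_functional ?J \<psi>" if "\<psi> \<in> \<phi> ` ?T" for \<psi>
    using that linear_functional_local_equation_form[of ?J "\<lambda>p. p" d]
    by (auto simp: \<phi>_def)
  have "finite (\<phi> ` ?T)" using assms(1) by simp
  then obtain x where x: "\<exists>p\<in>?J. x p \<noteq> 0" "\<And>\<psi>. \<psi> \<in> \<phi> ` ?T \<Longrightarrow> \<psi> x = 0"
    using underdetermined_system[OF _ finite_triangle card lin] by blast
  obtain j k where jk: "j + k \<le> d" "x (j, k) \<noteq> 0" using x(1) by (auto simp: less_Suc_eq_le)
  have "coeff3 (form_with_coeffs d x) (d - j - k) j k \<noteq> 0"
    using jk by (simp add: coeff3_form_with_coeffs)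
  then have "form_with_coeffs d x \<noteq> 0" by auto
  moreover have "vanishes_to (m i) (local_equation (form_with_coeffs d x) (s i) (t i))" if "i \<in> I" for i
    unfolding vanishes_to_def
  proof (intro allI impI)
    fix j k assume "j + k < m i"
    then have "\<phi> (i, j, k) x = 0" using that by (intro x(2) imageI) auto
    then show "coeff2 (local_equation (form_with_coeffs d x) (s i) (t i)) j k = 0" by (simp add: \<phi>_def)
  qed
  ultimately show ?thesis using ternary_form_with_coeffs by blast
qed

text \<open>If the inequality failed, one could find forms \<open>h\<close>, \<open>k\<close> and an interpolating form \<open>P\<close>, not all
  zero, with \<open>f h + g k = P\<close>, where \<open>h\<close> and \<open>k\<close> vanish at the points to the order of \<open>g\<close> and \<open>f\<close> and
  \<open>h\<close> has no terms divisible by the leading monomial of \<open>g\<close>. The order of vanishing forces \<open>P = 0\<close>, so \<open>h\<close> is a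
  multiple of \<open>g\<close>, hence zero.\<close>

lemma Bezout_inequality:
  fixes f g :: "'l::field poly poly poly" and s t :: "'i \<Rightarrow> 'l"
  assumes I: "finite I" and inj: "inj_on s I"
    and f: "ternary_form d f" "prime_elem f" and g: "ternary_form e g" "\<not> f dvd g"
    and vf: "\<And>i. i \<in> I \<Longrightarrow> vanishes_to (\<mu> i) (local_equation f (s i) (t i))"
    and vg: "\<And>i. i \<in> I \<Longrightarrow> vanishes_to (m i) (local_equation g (s i) (t i))"
  shows "(\<Sum>i\<in>I. \<mu> i * m i) \<le> d * e"
proof (rule ccontr)
  assume big: "\<not> ?thesis"
  have f0: "f \<noteq> 0" and g0: "g \<noteq> 0" using f(2) g(2) by auto
  \<comment> \<open>The order to which \<open>f h\<close> and \<open>g k\<close> will vanish at each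
    point. Degrees are raised by the total \<open>M\<close>, so that in degree \<open>n\<close>
    every Taylor coefficient of order below \<open>N i\<close> has its interpolation form.\<close>
  define N where "N = (\<lambda>i. \<mu> i + m i)"
  define M where "M = (\<Sum>i\<in>I. N i)"
  define n where "n = d + e + M"
  define T where "T = (SIGMA i:I. triangle (N i))"
  define J :: "(nat \<times> nat + nat \<times> nat + 'i \<times> nat \<times> nat) set" where
    "J = triangle (Suc (e + M)) <+> triangle (Suc (d + M)) <+> T"
  define h where "h = (\<lambda>x :: nat \<times> nat + nat \<times> nat + 'i \<times> nat \<times> nat \<Rightarrow> 'l. form_with_coeffs (e + M) (\<lambda>p. x (Inl p)))"
  define k where "k = (\<lambda>x :: nat \<times> nat + nat \<times> nat + 'i \<times> nat \<times> nat \<Rightarrow> 'l. form_with_coeffs (d + M) (\<lambda>p. x (Inr (Inl p))))"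
  define q where "q = (\<lambda>(i, a, b). interpolation_form I s t N n i a b)"
  define P where "P = (\<lambda>x :: nat \<times> nat + nat \<times> nat + 'i \<times> nat \<times> nat \<Rightarrow> 'l. \<Sum>\<tau>\<in>T. smult [:[:x (Inr (Inr \<tau>)):]:] (q \<tau>))"
  \<comment> \<open>Exponents of the lexicographically leading monomial of \<open>g\<close>.\<close>
  define i0 where "i0 = degree g"
  define j0 where "j0 = degree (lead_coeff g)"
  define k0 where "k0 = degree (lead_coeff (lead_coeff g))"
  \<comment> \<open>The conditions, in order: the identity \<open>f h + g k = P\<close>, the
    vanishing of \<open>h\<close>, that of \<open>k\<close>, and the absence from \<open>h\<close>
    of multiples of the leading monomial of \<open>g\<close>. The last family excludes the trivial
    solutions \<open>h = - g c\<close>, \<open>k = f c\<close> with \<open>c\<close> of degree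
    \<open>M\<close>.\<close>
  define \<phi>1 where "\<phi>1 = (\<lambda>(a, b) x. coeff3 (f * h x + g * k x - P x) (n - a - b) a b)"
  define \<phi>2 where "\<phi>2 = (\<lambda>(i, a, b) x. coeff2 (local_equation (h x) (s i) (t i)) a b)"
  define \<phi>3 where "\<phi>3 = (\<lambda>(i, a, b) x. coeff2 (local_equation (k x) (s i) (t i)) a b)"
  define \<phi>4 where "\<phi>4 = (\<lambda>(a, b) x. coeff3 (h x) (i0 + (M - a - b)) (j0 + a) (k0 + b))"
  define \<Phi> where "\<Phi> = \<phi>1 ` triangle (Suc n) \<union> \<phi>2 ` (SIGMA i:I. triangle (m i)) \<union>
    \<phi>3 ` (SIGMA i:I. triangle (\<mu> i)) \<union> \<phi>4 ` triangle (Suc M)"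
  have finT: "finite T" using I by (simp add: T_def)
  have finJ: "finite J" using finT by (simp add: J_def)
  have fin\<Phi>: "finite \<Phi>" using I by (simp add: \<Phi>_def)
  have hJ: "Inl ` triangle (Suc (e + M)) \<subseteq> J" and kJ: "(\<lambda>p. Inr (Inl p)) ` triangle (Suc (d + M)) \<subseteq> J"
    by (auto simp: J_def)

  have "card \<Phi> \<le> card (triangle (Suc n)) + (\<Sum>i\<in>I. card (triangle (m i))) +
      (\<Sum>i\<in>I. card (triangle (\<mu> i))) + card (triangle (Suc M))"
  proof -
    have union: "card (A \<union> B \<union> C \<union> D) \<le> card A + card B + card C + card D"
      for A B C D :: "(_ \<Rightarrow> 'l) set"
      using card_Un_le[of "A \<union> B \<union> C" D] card_Un_le[of "A \<union> B" C] card_Un_le[of A B] by linarith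
    have "card (\<phi>1 ` triangle (Suc n)) \<le> card (triangle (Suc n))"
      by (rule card_image_le) simp
    moreover have "card (\<phi>4 ` triangle (Suc M)) \<le> card (triangle (Suc M))"
      by (rule card_image_le) simp
    moreover have "card (\<phi>2 ` (SIGMA i:I. triangle (m i))) \<le> (\<Sum>i\<in>I. card (triangle (m i)))"
      unfolding card_Sigma_triangle[OF I, symmetric] using I by (intro card_image_le) simp
    moreover have "card (\<phi>3 ` (SIGMA i:I. triangle (\<mu> i))) \<le> (\<Sum>i\<in>I. card (triangle (\<mu> i)))"
      unfolding card_Sigma_triangle[OF I, symmetric] using I by (intro card_image_le) simp
    ultimately show ?thesis unfolding \<Phi>_def by (intro order_trans[OF union] add_mono)
  qed
  \<comment> \<open>All triangular numbers cancel and the cross terms remain: the excess of unknowns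
    is at least \<Sum> \<open>\<mu> i * m i\<close> minus \<open>d * e\<close>.\<close>
  also have "\<dots> < card J"
  proof -
    have "card J = card (triangle (Suc (e + M))) + card (triangle (Suc (d + M))) +
        (\<Sum>i\<in>I. card (triangle (N i)))"
      using finT I by (simp add: J_def card_Plus T_def card_Sigma_triangle)
    also have "(\<Sum>i\<in>I. card (triangle (N i))) = (\<Sum>i\<in>I. card (triangle (\<mu> i))) +
        (\<Sum>i\<in>I. card (triangle (m i))) + (\<Sum>i\<in>I. \<mu> i * m i)"
      by (simp add: N_def card_triangle_add sum.distrib)
    finally have J: "card J = card (triangle (Suc (e + M))) + card (triangle (Suc (d + M))) +
        ((\<Sum>i\<in>I. card (triangle (\<mu> i))) + (\<Sum>i\<in>I. card (triangle (m i))) + (\<Sum>i\<in>I. \<mu> i * m i))" .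
    have "card (triangle (Suc n)) + card (triangle (Suc M)) =
        card (triangle (Suc (e + M))) + card (triangle (Suc (d + M))) + d * e"
      using card_triangle_add[of d "Suc (e + M)"] card_triangle_add[of d "Suc M"]
      by (simp add: n_def add.assoc algebra_simps)
    then show ?thesis using J big by linarith
  qed
  finally have card: "card \<Phi> < card J" .

  have lin_h: "linear_functional J (\<lambda>x. coeff3 (h x) i a b)" for i a b
    unfolding h_def by (rule linear_functional_coeff3_form[OF finJ hJ])
  have lin_k: "linear_functional J (\<lambda>x. coeff3 (k x) i a b)" for i a b
    unfolding k_def by (rule linear_functional_coeff3_form[OF finJ kJ])
  have lin_P: "linear_functional J (\<lambda>x. coeff3 (P x) i a b)" for i a b
  proof -
    have "coeff3 (P x) i a b = (\<Sum>\<tau>\<in>T. x (Inr (Inr \<tau>)) * coeff3 (q \<tau>) i a b)" for x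
      by (simp add: P_def coeff_sum)
    then show ?thesis using finJ
      by (auto simp: J_def intro!: linear_functional_sum linear_functional_scale linear_functional_coordinate)
  qed
  have lin: "linear_functional J \<phi>" if "\<phi> \<in> \<Phi>" for \<phi>
  proof -
    have "linear_functional J (\<phi>1 (a, b))" for a b
      using linear_functional_diff[OF linear_functional_add[OF
            linear_functional_coeff3_mult[of J h f, OF lin_h]
            linear_functional_coeff3_mult[of J k g, OF lin_k]] lin_P]
      by (simp add: \<phi>1_def)
    moreover have "linear_functional J (\<phi>2 (i, a, b))" for i a b
      using linear_functional_local_equation_form[OF finJ hJ] by (simp add: \<phi>2_def h_def)
    moreover have "linear_functional J (\<phi>3 (i, a, b))" for i a b
      using linear_functional_local_equation_form[OF finJ kJ] by (simp add: \<phi>3_def k_def)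
    moreover have "linear_functional J (\<phi>4 (a, b))" for a b
      using lin_h by (simp add: \<phi>4_def)
    ultimately show ?thesis using that unfolding \<Phi>_def by auto
  qed
  obtain x where x: "\<exists>j\<in>J. x j \<noteq> 0" and eqs: "\<And>\<phi>. \<phi> \<in> \<Phi> \<Longrightarrow> \<phi> x = 0"
    using underdetermined_system[OF fin\<Phi> finJ card lin] by blast

  have form_h: "ternary_form (e + M) (h x)" and form_k: "ternary_form (d + M) (k x)"
    unfolding h_def k_def by (rule ternary_form_with_coeffs)+
  have form_q: "ternary_form n (q \<tau>)" if "\<tau> \<in> T" for \<tau>
    using that I unfolding q_def T_def
    by (auto intro!: ternary_form_interpolation_form simp: n_def M_def)
  have form_P: "ternary_form n (P x)"
    unfolding P_def
  proof (rule ternary_form_sum)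
    fix \<tau> assume "\<tau> \<in> T"
    then show "ternary_form n (smult [:[:x (Inr (Inr \<tau>)):]:] (q \<tau>))"
      using form_q[of \<tau>] by (auto simp: ternary_form_def)
  qed
  have form_fh: "ternary_form n (f * h x + g * k x)"
    using ternary_form_mult[OF f(1) form_h] ternary_form_mult[OF g(1) form_k]
    by (intro ternary_form_add) (simp_all add: n_def add_ac)
  have fhgk: "f * h x + g * k x = P x"
  proof (rule ternary_form_eqI[OF form_fh form_P])
    fix a b assume "a + b \<le> n"
    then have "\<phi>1 (a, b) x = 0" by (intro eqs) (auto simp: \<Phi>_def)
    then show "coeff3 (f * h x + g * k x) (n - a - b) a b = coeff3 (P x) (n - a - b) a b"
      by (simp add: \<phi>1_def)
  qed
  have vP: "vanishes_to (N i) (local_equation (P x) (s i) (t i))" if i: "i \<in> I" for i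
  proof -
    have "vanishes_to (m i) (local_equation (h x) (s i) (t i))"
      unfolding vanishes_to_def
    proof (intro allI impI)
      fix a b assume "a + b < m i"
      then have "\<phi>2 (i, a, b) x = 0" using i by (intro eqs) (auto simp: \<Phi>_def)
      then show "coeff2 (local_equation (h x) (s i) (t i)) a b = 0" by (simp add: \<phi>2_def)
    qed
    moreover have "vanishes_to (\<mu> i) (local_equation (k x) (s i) (t i))"
      unfolding vanishes_to_def
    proof (intro allI impI)
      fix a b assume "a + b < \<mu> i"
      then have "\<phi>3 (i, a, b) x = 0" using i by (intro eqs) (auto simp: \<Phi>_def)
      then show "coeff2 (local_equation (k x) (s i) (t i)) a b = 0" by (simp add: \<phi>3_def)
    qed
    ultimately show ?thesis
      unfolding fhgk[symmetric] local_equation_add local_equation_mult N_def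
      using vanishes_to_mult[OF vf[OF i]] vanishes_to_mult[OF vg[OF i]]
      by (metis add.commute vanishes_to_add)
  qed
  \<comment> \<open>Among nonzero multipliers one of least order \<open>a + b\<close> is chosen. No
    other term of \<open>P x\<close> reaches its monomial at its point: forms for other points
    vanish there to order \<open>N i\<close>, and those for the same point start with another
    monomial of at least the same order. So the coefficient survives, against
    \<open>vP\<close>.\<close>
  have xT: "x (Inr (Inr \<tau>)) = 0" if "\<tau> \<in> T" for \<tau>
  proof (rule ccontr)
    define S where "S = {\<tau> \<in> T. x (Inr (Inr \<tau>)) \<noteq> 0}"
    define w :: "'i \<times> nat \<times> nat \<Rightarrow> nat" where "w = (\<lambda>(i, a, b). a + b)"
    assume "x (Inr (Inr \<tau>)) \<noteq> 0"
    with that have "\<tau> \<in> S" by (simp add: S_def)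
    then obtain \<rho> where \<rho>: "\<rho> \<in> S" "\<And>\<tau>. \<tau> \<in> S \<Longrightarrow> w \<rho> \<le> w \<tau>"
      using ex_has_least_nat[of "\<lambda>\<tau>. \<tau> \<in> S" \<tau> w] by blast
    obtain i a b where iab: "\<rho> = (i, a, b)" by (cases \<rho>)
    have i: "i \<in> I" and ab: "a + b < N i" and xr: "x (Inr (Inr \<rho>)) \<noteq> 0"
      using \<rho>(1) by (auto simp: S_def T_def iab)
    let ?c = "\<lambda>\<tau>. coeff2 (local_equation (q \<tau>) (s i) (t i)) a b"
    have other: "x (Inr (Inr \<tau>)) * ?c \<tau> = 0" if \<tau>: "\<tau> \<in> T - {\<rho>}" for \<tau>
    proof (cases "x (Inr (Inr \<tau>)) = 0")
      case False
      obtain i' a' b' where \<tau>': "\<tau> = (i', a', b')" by (cases \<tau>)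
      have "w \<rho> \<le> w \<tau>" using \<tau> False by (intro \<rho>(2)) (auto simp: S_def)
      then have le: "a + b \<le> a' + b'" by (simp add: w_def iab \<tau>')
      have "?c \<tau> = 0"
      proof (cases "i' = i")
        case True
        then show ?thesis using interpolation_form_leading(2)[OF I inj i le] \<tau>
          by (auto simp: q_def \<tau>' iab)
      next
        case False
        then show ?thesis using interpolation_form_vanishes[OF I i, of i' N s t n a' b'] ab
          by (auto simp: q_def \<tau>' vanishes_to_def)
      qed
      then show ?thesis by simp
    qed simp
    have "coeff2 (local_equation (P x) (s i) (t i)) a b = (\<Sum>\<tau>\<in>T. x (Inr (Inr \<tau>)) * ?c \<tau>)"
      by (simp add: P_def local_equation_sum local_equation_smult coeff_sum)
    also have "\<dots> = x (Inr (Inr \<rho>)) * ?c \<rho>"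
    proof -
      have "(\<Sum>\<tau>\<in>T - {\<rho>}. x (Inr (Inr \<tau>)) * ?c \<tau>) = 0" using other by (intro sum.neutral ballI)
      then show ?thesis using \<rho>(1) finT by (subst sum.remove[of T \<rho>]) (simp_all add: S_def)
    qed
    also have "\<dots> \<noteq> 0"
      using xr interpolation_form_leading(1)[OF I inj i] by (simp add: q_def iab)
    finally show False using vP[OF i] ab by (simp add: vanishes_to_def)
  qed
  then have "P x = 0" by (simp add: P_def)
  then have eq: "f * h x = - (g * k x)" using fhgk by (simp add: eq_neg_iff_add_eq_0)
  have "f dvd - (g * k x)" unfolding eq[symmetric] by (rule dvd_triv_left)
  then have "f dvd g * k x" by (simp only: dvd_minus_iff)
  then have "f dvd k x" using prime_elem_dvd_multD[OF f(2)] g(2) by blast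
  then obtain c where c: "k x = f * c" by (rule dvdE)
  have "f * h x = f * - (g * c)" unfolding eq c by (simp add: mult_ac)
  then have hc: "h x = - (g * c)" using f0 by (simp only: mult_cancel_left) simp
  \<comment> \<open>Leading monomials multiply, so the leading term of \<open>g * c\<close> sits
    where the fourth family makes \<open>h x\<close> vanish.\<close>
  have "c = 0"
  proof (rule ccontr)
    assume c0: "c \<noteq> 0"
    define i1 where "i1 = degree c"
    define j1 where "j1 = degree (lead_coeff c)"
    define k1 where "k1 = degree (lead_coeff (lead_coeff c))"
    have "coeff3 (g * c) (i0 + i1) (j0 + j1) (k0 + k1) =
        lead_coeff (lead_coeff (lead_coeff g)) * lead_coeff (lead_coeff (lead_coeff c))"
      unfolding i0_def j0_def k0_def i1_def j1_def k1_def by (simp only: coeff_mult_degree_sum)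
    then have nz: "coeff3 (h x) (i0 + i1) (j0 + j1) (k0 + k1) \<noteq> 0"
      using g0 c0 by (simp add: hc)
    then have "i0 + i1 + (j0 + j1) + (k0 + k1) = e + M"
      using form_h by (auto simp: ternary_form_def)
    moreover have "coeff3 g i0 j0 k0 \<noteq> 0" using g0 by (simp add: i0_def j0_def k0_def)
    then have "i0 + j0 + k0 = e" using g(1) by (auto simp: ternary_form_def)
    ultimately have "i1 = M - j1 - k1" "j1 + k1 \<le> M" by linarith+
    moreover from this have "\<phi>4 (j1, k1) x = 0" by (intro eqs) (auto simp: \<Phi>_def)
    ultimately show False using nz by (simp add: \<phi>4_def)
  qed
  then have "h x = 0" "k x = 0" using hc c by simp_all
  then have "x (Inl p) = 0" if "p \<in> triangle (Suc (e + M))" for p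
    using that coeff3_form_with_coeffs[of "e + M" "\<lambda>p. x (Inl p)" "e + M - fst p - snd p" "fst p" "snd p"]
    by (cases p) (simp add: h_def)
  moreover have "x (Inr (Inl p)) = 0" if "p \<in> triangle (Suc (d + M))" for p
    using that \<open>k x = 0\<close>
      coeff3_form_with_coeffs[of "d + M" "\<lambda>p. x (Inr (Inl p))" "d + M - fst p - snd p" "fst p" "snd p"]
    by (cases p) (simp add: k_def)
  ultimately show False using x xT by (auto simp: J_def)
qed

text \<open>Copies of \<open>f\<close> are split off from \<open>g\<close>. Each lowers the right
  side by \<open>d * d\<close> and the left side by the smaller \<Sum>
  \<open>\<mu> i * \<mu> i\<close>, so the inequality for the cofactor implies the one for
  \<open>g\<close>. The \<open>m i\<close> are integers because they drop by \<open>\<mu> i\<close>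
  and may turn negative, where \<open>nat\<close> makes the condition empty.\<close>

lemma effective_intersection_nonneg:
  fixes f g :: "'l::field poly poly poly" and s t :: "'i \<Rightarrow> 'l" and m :: "'i \<Rightarrow> int"
  assumes I: "finite I" and inj: "inj_on s I"
    and f: "ternary_form d f" "irreducible f" and \<mu>: "\<And>i. \<mu> i = multiplicity_at f (s i) (t i)"
    and pos: "(\<Sum>i\<in>I. \<mu> i * \<mu> i) < d * d"
    and g: "ternary_form e g" "g \<noteq> 0"
    and vg: "\<And>i. i \<in> I \<Longrightarrow> vanishes_to (nat (m i)) (local_equation g (s i) (t i))"
  shows "(\<Sum>i\<in>I. int (\<mu> i) * m i) \<le> int d * int e"
  using g vg
proof (induction e arbitrary: g m rule: less_induct)
  case (less e)
  have f0: "f \<noteq> 0" using f(2) by auto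
  \<comment> \<open>Iterated polynomial rings over a field are factorial.\<close>
  have prime: "prime_elem f" using f(2) by simp
  have d: "0 < d" using pos by (cases d) auto
  have vf: "vanishes_to (\<mu> i) (local_equation f (s i) (t i))" for i
    unfolding \<mu> by (rule vanishes_to_multiplicity_at)
  show ?case
  proof (cases "f dvd g")
    case False
    have "(\<Sum>i\<in>I. int (\<mu> i) * m i) \<le> (\<Sum>i\<in>I. int (\<mu> i) * int (nat (m i)))"
      by (intro sum_mono mult_left_mono) auto
    also have "\<dots> = int (\<Sum>i\<in>I. \<mu> i * nat (m i))" by simp
    also have "\<dots> \<le> int (d * e)"
      unfolding of_nat_le_iff
      by (rule Bezout_inequality[OF I inj f(1) prime less.prems(1) False vf less.prems(3)])
    finally show ?thesis by simp
  next
    case True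
    then obtain h where h: "g = f * h" by (rule dvdE)
    note form = ternary_form_cofactor[OF f(1), of e h]
    have de: "d \<le> e" and form_h: "ternary_form (e - d) h"
      using form less.prems h by auto
    have "(\<Sum>i\<in>I. int (\<mu> i) * (m i - int (\<mu> i))) \<le> int d * int (e - d)"
    proof (rule less.IH)
      show "e - d < e" using d de by simp
      show "ternary_form (e - d) h" by (rule form_h)
      show "h \<noteq> 0" using less.prems(2) h by auto
      fix i assume i: "i \<in> I"
      obtain j k where "j + k = \<mu> i" "coeff2 (local_equation f (s i) (t i)) j k \<noteq> 0"
        using multiplicity_at_attained[OF f(1) f0] \<mu> by metis
      then have "vanishes_to (nat (m i) - \<mu> i) (local_equation h (s i) (t i))"
        using vf less.prems(3)[OF i] unfolding h local_equation_mult
        by (intro vanishes_to_cofactor[of "\<mu> i" "local_equation f (s i) (t i)" j k])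
      also have "nat (m i) - \<mu> i = nat (m i - int (\<mu> i))" by simp
      finally show "vanishes_to (nat (m i - int (\<mu> i))) (local_equation h (s i) (t i))" .
    qed
    moreover have "(\<Sum>i\<in>I. int (\<mu> i) * (m i - int (\<mu> i))) =
        (\<Sum>i\<in>I. int (\<mu> i) * m i) - int (\<Sum>i\<in>I. \<mu> i * \<mu> i)"
      by (simp add: right_diff_distrib sum_subtractf)
    moreover have "int d * int (e - d) = int d * int e - int (d * d)"
      using de by (simp add: of_nat_diff right_diff_distrib)
    moreover have "int (\<Sum>i\<in>I. \<mu> i * \<mu> i) < int (d * d)" using pos by (simp only: of_nat_less_iff)
    ultimately show ?thesis by linarith
  qed
qed

text \<open>A coincidence would be an algebraic relation between two of the variables, namely that
  their difference vanishes.\<close>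

lemma generic_points_distinct:
  fixes \<iota> :: "'k::field \<Rightarrow> 'l::field"
  assumes "generic_points \<iota> r s t"
  shows "inj_on s {1..r}"
proof (rule inj_onI, rule ccontr)
  fix i j assume ij: "i \<in> {1..r}" "j \<in> {1..r}" and eq: "s i = s j" and neq: "i \<noteq> j"
  define u v :: "nat + nat \<Rightarrow>\<^sub>0 nat"
    where "u = Poly_Mapping.single (Inl i) 1" and "v = Poly_Mapping.single (Inl j) 1"
  define P :: "(nat + nat \<Rightarrow>\<^sub>0 nat) \<Rightarrow>\<^sub>0 'k"
    where "P = Poly_Mapping.single u 1 - Poly_Mapping.single v 1"
  have \<iota>: "\<iota> 1 = 1" "\<And>a b. \<iota> (a + b) = \<iota> a + \<iota> b"
    and indep: "\<And>P. mpoly_vars P \<subseteq> {1..r} <+> {1..r} \<Longrightarrow> mpoly_eval \<iota> (case_sum s t) P = 0 \<Longrightarrow> P = 0"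
    using assms by (auto simp: generic_points_def)
  have "\<iota> 0 = 0" using \<iota>(2)[of 0 0] by (metis add_0 add_cancel_right_right)
  then have m1: "\<iota> (- 1) = - 1" using \<iota>(1) \<iota>(2)[of 1 "- 1"] by (simp add: eq_neg_iff_add_eq_0 add.commute)
  have uv: "u \<noteq> v" using neq by (auto simp: u_def v_def dest!: arg_cong[of _ _ Poly_Mapping.keys])
  have lookup: "Poly_Mapping.lookup P \<kappa> = (if \<kappa> = u then 1 else if \<kappa> = v then - 1 else 0)" for \<kappa>
    using uv by (auto simp: P_def lookup_minus lookup_single when_def)
  have keys: "Poly_Mapping.keys P = {u, v}"
    by (auto simp: in_keys_iff lookup split: if_splits)
  have "mpoly_eval \<iota> (case_sum s t) P = s i - s j"
    using uv by (simp add: mpoly_eval_def keys lookup \<iota>(1) m1) (simp add: u_def v_def)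
  moreover have "mpoly_vars P \<subseteq> {1..r} <+> {1..r}"
    using ij by (auto simp: mpoly_vars_def keys u_def v_def)
  ultimately have "P = 0" using indep eq by simp
  then show False using lookup[of u] by simp
qed

section \<open>Minimal intersection numbers\<close>

lemma exceptional_configuration_nef:
  fixes \<iota> :: "'k::field \<Rightarrow> 'l::field"
  assumes "generic_points \<iota> r s t" and F: "exceptional_configuration r s t F"
  shows "exceptionally_nef r (F 0)"
  unfolding exceptionally_nef_def
proof (intro allI impI, elim conjE)
  fix x
  assume x: "intersection r x x = -1" "intersection r x (canonical_class r) = -1" "0 \<le> x 0"
  have square: "intersection r (F 0) (F 0) = 1" and "effective_irreducible_class r s t (F 0)"
    using F by (auto simp: exceptional_configuration_def)
  \<comment> \<open>Exceptional curves of the blow-up have square -1, so \<open>F 0\<close> comes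
    from a plane curve.\<close>
  moreover have "F 0 \<noteq> std_frame i" if "i \<in> {1..r}" for i
  proof
    assume "F 0 = std_frame i"
    with square that show False
      by (simp add: intersection_std_frame) (simp add: blowup_exceptional_class_def split: if_splits)
  qed
  ultimately obtain d f where f: "ternary_form d f" "irreducible f" "F 0 = proper_transform_class r s t d f"
    unfolding effective_irreducible_class_def by blast
  define \<mu> where "\<mu> = (\<lambda>i. multiplicity_at f (s i) (t i))"
  have F0: "F 0 0 = int d" "\<And>i. i \<in> {1..r} \<Longrightarrow> F 0 i = - int (\<mu> i)"
    by (auto simp: f(3) proper_transform_class_def \<mu>_def)
  have F0_sum: "(\<Sum>i=1..r. F 0 i * y i) = - (\<Sum>i=1..r. int (\<mu> i) * y i)" for y
    by (simp add: F0(2) sum_negf)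
  define e where "e = nat (x 0)"
  have e: "x 0 = int e" using x(3) by (simp add: e_def)
  have "int d * int d - (\<Sum>i=1..r. int (\<mu> i) * int (\<mu> i)) = 1"
    using square by (simp add: intersection_def F0)
  then have "int (\<Sum>i=1..r. \<mu> i * \<mu> i) < int (d * d)" by simp
  then have pos: "(\<Sum>i=1..r. \<mu> i * \<mu> i) < d * d" by (simp only: of_nat_less_iff)
  \<comment> \<open>The squares of the \<open>x i\<close> sum to \<open>e^2 + 1\<close> and the
    \<open>x i\<close> to \<open>1 - 3 e\<close>. Twice the number of conditions is therefore at
    most \<open>e^2 + 3 e\<close>, two less than \<open>(e + 1)(e + 2)\<close>; a positive
    \<open>x i\<close> imposes none.\<close>
  have count: "(\<Sum>i=1..r. card (triangle (nat (- x i)))) < card (triangle (Suc e))"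
  proof -
    have tri: "2 * int (card (triangle n)) = int n * (int n + 1)" for n
      using arg_cong[OF card_triangle[of n], of int] by (simp add: algebra_simps)
    have "2 * (\<Sum>i=1..r. int (card (triangle (nat (- x i))))) \<le> (\<Sum>i=1..r. x i * x i - x i)"
      unfolding sum_distrib_left tri
    proof (rule sum_mono)
      fix i
      show "int (nat (- x i)) * (int (nat (- x i)) + 1) \<le> x i * x i - x i"
      proof (cases "0 < x i")
        case True
        then have "0 \<le> x i * (x i - 1)" by (intro mult_nonneg_nonneg) auto
        with True show ?thesis by (simp add: right_diff_distrib)
      qed (simp add: algebra_simps)
    qed
    also have "\<dots> = int e * int e + 3 * int e"
      using x(1,2) by (simp add: sum_subtractf intersection_canonical) (simp add: intersection_def e)
    also have "\<dots> < 2 * int (card (triangle (Suc e)))" unfolding tri by (simp add: algebra_simps)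
    finally have "int (\<Sum>i=1..r. card (triangle (nat (- x i)))) < int (card (triangle (Suc e)))" by simp
    then show ?thesis by (simp only: of_nat_less_iff)
  qed
  then obtain g where g: "ternary_form e g" "g \<noteq> 0"
    "\<And>i. i \<in> {1..r} \<Longrightarrow> vanishes_to (nat (- x i)) (local_equation g (s i) (t i))"
    using exists_form_vanishing[OF _ count, of s t] by auto
  have "(\<Sum>i=1..r. int (\<mu> i) * - x i) \<le> int d * int e"
    by (rule effective_intersection_nonneg[OF _ generic_points_distinct[OF assms(1)] f(1,2) _ pos g])
      (simp_all add: \<mu>_def)
  then show "0 \<le> intersection r (F 0) x"
    unfolding intersection_def F0_sum by (simp add: F0 e sum_negf)
qed

theorem proposition4p12:
  fixes \<iota> :: "'k::field \<Rightarrow> 'l::field" and r :: nat and s t :: "nat \<Rightarrow> 'l"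
    and E B :: "nat \<Rightarrow> divisor_class" and H D :: divisor_class
    and d :: int and m :: "nat \<Rightarrow> int" and W :: "(divisor_class \<Rightarrow> divisor_class) set"
  assumes "generic_points \<iota> r s t"
    and "exceptional_configuration r s t B" and "W = weyl_group r B"
    and "exceptional_configuration r s t E"
    and "H = class_of r E d m" and "standard_coeffs r d m"
    and "semi_standard r s t D"
  shows "(\<exists>\<sigma>\<in>W. semi_standard_wrt r E (\<sigma> D)) \<and>
    (\<forall>\<sigma>\<in>W. semi_standard_wrt r E (\<sigma> D) \<longrightarrow>
       (\<forall>\<tau>\<in>W. intersection r H (\<sigma> D) \<le> intersection r H (\<tau> D))) \<and>
    (\<forall>F d' m'. exceptional_configuration r s t F \<and> D = class_of r F d' m' \<and>
       semi_standard_coeffs r d' m' \<longrightarrow>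
       intersection r H D \<ge> intersection r H (class_of r E d' m'))"
proof -
  note B = assms(2) and W = assms(3) and E = assms(4) and H = assms(5) and std = assms(6)
    and D = assms(7) and nef = exceptional_configuration_nef[OF assms(1)]
  note frame = exceptional_configuration_frame[OF E]
  have eq: "weyl_group r F = weyl_group r std_frame" if F: "exceptional_configuration r s t F" for F
  proof -
    obtain \<sigma> where "\<sigma> \<in> weyl_group r std_frame" "\<forall>i\<le>r. F i = \<sigma> (std_frame i)"
      using exceptional_configuration_in_orbit[OF F nef[OF F]] by blast
    then show ?thesis using weyl_group_eq[OF lorentz_frame_std] by blast
  qed
  then have WE: "W = weyl_group r E" using B E W by simp
  have comp: "\<sigma> \<circ> \<tau> \<in> W" if "\<sigma> \<in> W" "\<tau> \<in> W" for \<sigma> \<tau>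
    using weyl_group_comp that unfolding WE .
  have trans: "\<exists>\<sigma>\<in>W. \<forall>i\<le>r. F i = \<sigma> (E i)" if F: "exceptional_configuration r s t F" for F
  proof -
    have W0: "W = weyl_group r std_frame" using eq B W by simp
    obtain \<sigma> where \<sigma>: "\<sigma> \<in> W" "\<forall>i\<le>r. F i = \<sigma> (std_frame i)"
      using exceptional_configuration_in_orbit[OF F nef[OF F]] unfolding W0 by blast
    obtain \<tau> where \<tau>: "\<tau> \<in> W" "\<forall>i\<le>r. E i = \<tau> (std_frame i)"
      using exceptional_configuration_in_orbit[OF E nef[OF E]] unfolding W0 by blast
    obtain \<tau>' where \<tau>': "\<tau>' \<in> W" "\<tau>' \<circ> \<tau> = id"
      using weyl_group_inverse[OF lorentz_frame_std[of r]] \<tau>(1) unfolding W0 by blast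
    have "\<forall>i\<le>r. F i = (\<sigma> \<circ> \<tau>') (E i)" using \<sigma>(2) \<tau>(2) by (simp add: pointfree_idE[OF \<tau>'(2)])
    with comp[OF \<sigma>(1) \<tau>'(1)] show ?thesis by blast
  qed
  have inv: "\<exists>\<tau>\<in>W. \<tau> \<circ> \<sigma> = id \<and> \<sigma> \<circ> \<tau> = id" if "\<sigma> \<in> W" for \<sigma>
    using weyl_group_inverse[OF frame] that unfolding WE .
  have dom: "dominant r E (class_of r E d m)" if "semi_standard_coeffs r d m" for d m
    using semi_standard_dominant[OF frame that] .
  have domH: "dominant r E H" using dom standard_imp_semi_standard[OF std] H by simp
  have min: "intersection r H (class_of r E d' m') \<le> intersection r H (\<sigma> (class_of r E d' m'))"
    if "semi_standard_coeffs r d' m'" "\<sigma> \<in> W" for d' m' \<sigma>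
    using dominant_minimal_in_orbit[OF frame domH dom[OF that(1)]] that(2) unfolding WE .
  have orbit: "\<exists>\<sigma>\<in>W. D = \<sigma> (class_of r E d' m')"
    if F: "exceptional_configuration r s t F" "D = class_of r F d' m'" for F d' m'
  proof -
    obtain \<sigma> where "\<sigma> \<in> W" "\<forall>i\<le>r. F i = \<sigma> (E i)" using trans[OF F(1)] by blast
    then show ?thesis using weyl_group_class_of[of \<sigma> r E F E] F(2) unfolding WE by blast
  qed
  show ?thesis
  proof (intro conjI)
    obtain F d' m' where F: "exceptional_configuration r s t F" "D = class_of r F d' m'"
        "semi_standard_coeffs r d' m'"
      using D by (auto simp: semi_standard_def semi_standard_wrt_def)
    then obtain \<sigma> where \<sigma>: "\<sigma> \<in> W" "D = \<sigma> (class_of r E d' m')" using orbit by blast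
    \<comment> \<open>Undoing \<sigma> turns \<open>D\<close> into the class with the same
      coefficients in the basis \<open>E\<close>.\<close>
    obtain \<tau> where "\<tau> \<in> W" "\<tau> \<circ> \<sigma> = id" using inv[OF \<sigma>(1)] by blast
    moreover from this have "\<tau> D = class_of r E d' m'" using \<sigma>(2) by (simp add: pointfree_idE)
    ultimately show "\<exists>\<sigma>\<in>W. semi_standard_wrt r E (\<sigma> D)"
      using F(3) unfolding semi_standard_wrt_def by blast
  next
    show "\<forall>\<sigma>\<in>W. semi_standard_wrt r E (\<sigma> D) \<longrightarrow>
       (\<forall>\<tau>\<in>W. intersection r H (\<sigma> D) \<le> intersection r H (\<tau> D))"
    proof (intro ballI impI)
      fix \<sigma> \<tau> assume \<sigma>: "\<sigma> \<in> W" "semi_standard_wrt r E (\<sigma> D)" and \<tau>: "\<tau> \<in> W"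
      obtain d' m' where d': "\<sigma> D = class_of r E d' m'" "semi_standard_coeffs r d' m'"
        using \<sigma>(2) by (auto simp: semi_standard_wrt_def)
      obtain \<sigma>' where \<sigma>': "\<sigma>' \<in> W" "\<sigma>' \<circ> \<sigma> = id" using inv[OF \<sigma>(1)] by blast
      \<comment> \<open>Minimality is applied with the dominant class \<open>\<sigma> D\<close> as
        base point of the orbit of \<open>D\<close>.\<close>
      have "intersection r H (\<sigma> D) \<le> intersection r H ((\<tau> \<circ> \<sigma>') (\<sigma> D))"
        unfolding d'(1) using min[OF d'(2) comp[OF \<tau> \<sigma>'(1)]] .
      also have "(\<tau> \<circ> \<sigma>') (\<sigma> D) = \<tau> D" by (simp add: pointfree_idE[OF \<sigma>'(2)])
      finally show "intersection r H (\<sigma> D) \<le> intersection r H (\<tau> D)" .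
    qed
  next
    show "\<forall>F d' m'. exceptional_configuration r s t F \<and> D = class_of r F d' m' \<and>
       semi_standard_coeffs r d' m' \<longrightarrow>
       intersection r H D \<ge> intersection r H (class_of r E d' m')"
    proof (intro allI impI, elim conjE)
      fix F d' m'
      assume F: "exceptional_configuration r s t F" "D = class_of r F d' m'"
        and semi: "semi_standard_coeffs r d' m'"
      obtain \<sigma> where "\<sigma> \<in> W" "D = \<sigma> (class_of r E d' m')" using orbit[OF F] by blast
      then show "intersection r H D \<ge> intersection r H (class_of r E d' m')"
        using min[OF semi] by simp
    qed
  qed
qed

end
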